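(* Let $\Gamma$ be a crystal base of classical type $A_n,B_n,C_n,D_n$ or $G_2$, and let $\sigma$ be a crystal normalization strategy for $\mathsf{Col}(\Gamma)$ (with respect to the section sending each element of the presented monoid to its normal form). Then the coherent extension of $\mathsf{Col}(\Gamma)$ obtained from $\sigma$, i.e. the family $\Omega$ of the 2-spheres $$\gamma_{c_1,c_2,c_3}=\big(P_cc_3\star_1\sigma_{P_c(c_1c_2)c_3},\ c_1P_c\star_1\sigma_{c_1P_c(c_2c_3)}\big)\qquad\text{with source } c_1c_2c_3 \text{ and target } P_c(c_1c_2c_3)$$ of $\mathsf{Col}(\Gamma)_2^\top$, over all columns $c_1,c_2,c_3\in\mathsf{Col}(\Gamma)_1$ with $P_c(c_1c_2)\ne c_1c_2$ and $P_c(c_2c_3)\neq c_2c_3$, is determined by those 2-spheres $\gamma_{c_1,c_2,c_3}$ for which moreover $c_1c_2c_3$ is of highest weight: every element of $\Omega$ is obtained from one of these by applying Kashiwara operators $f_i$. Here $P_cc_3$ and $c_1P_c$ denote the rewriting steps $c_1c_2c_3\Rightarrow P_c(c_1c_2)c_3$ and $c_1c_2c_3\Rightarrow c_1P_c(c_2c_3)$.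
   Context: Crystals. For a complex reductive Lie algebra with weight lattice $P$, dominant weights $P^+$, simple roots $\alpha_i$, simple coroots $\alpha_i^\vee$ ($i\in I$), a (normal) crystal is a set $\Gamma$ with maps $\mathrm{wt}:\Gamma\to P$, $\varepsilon_i,\varphi_i:\Gamma\to\mathbb Z$, $e_i,f_i:\Gamma\to\Gamma\sqcup\{0\}$ such that: $\varphi_i(x)-\varepsilon_i(x)=\langle\mathrm{wt}(x),\alpha_i^\vee\rangle$; $\varepsilon_i(x)=\max\{n:e_i^n.x\ne0\}$, $\varphi_i(x)=\max\{n:f_i^n.x\neq0\}$; $\mathrm{wt}(e_i.x)=\mathrm{wt}(x)+\alpha_i$ if $e_i.x\ne0$, $\mathrm{wt}(f_i.x)=\mathrm{wt}(x)-\alpha_i$ if $f_i.x\neq0$; $e_i.x=x'$ iff $f_i.x'=x$. The $e_i,f_i$ are the Kashiwara operators, $k$ denotes any one of them; the connected component of $x$ is the set of elements obtained from $x$ by successively applying them; an element is of highest weight if killed by all $e_i$. Morphisms of crystals are maps commuting with all structure maps (with $0\mapsto0$). "Crystal" always means a normal crystal whose connected components are all isomorphic to crystals $B(\lambda)$ of irreducible highest weight modules, $\lambda\in P^+$. The tensor product $\Gamma_1\otimes\Gamma_2$ is $\Gamma_1\times\Gamma_2$ with additive weight, $e_i.(u\otimes v)=(e_i.u)\otimes v$ if $\varphi_i(u)\ge\varepsilon_i(v)$ and $u\otimes(e_i.v)$ otherwise, $f_i.(u\otimes v)=(f_i.u)\otimes v$ if $\varphi_i(u)>\varepsilon_i(v)$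 and $u\otimes(f_i.v)$ otherwise. The free monoid $\Gamma^*=\bigsqcup_{n\ge0}\Gamma^{\otimes n}$ is a crystal. Crystal bases of classical type ($x\xrightarrow{i}y$ means $f_i.x=y$): $A_n$ ($n\ge2$): $1\xrightarrow{1}2\xrightarrow{2}\cdots\xrightarrow{n-1}n$, weights in $\mathbb Z^n$ with $\mathrm{wt}(i)$ the $i$-th unit vector. $B_n$ ($n\ge2$): $1\xrightarrow{1}\cdots\xrightarrow{n-1}n\xrightarrow{n}0\xrightarrow{n}\bar n\xrightarrow{n-1}\cdots\xrightarrow{1}\bar1$ (here $0$ is a letter). $C_n$ ($n\ge2$): $1\xrightarrow{1}\cdots\xrightarrow{n-1}n\xrightarrow{n}\bar n\xrightarrow{n-1}\cdots\xrightarrow{1}\bar1$. $D_n$ ($n\ge4$): $1\xrightarrow{1}\cdots\xrightarrow{n-2}n-1$, $n-1\xrightarrow{n-1}n$, $n-1\xrightarrow{n}\bar n$, $n\xrightarrow{n}\overline{n-1}$, $\bar n\xrightarrow{n-1}\overline{n-1}$, $\overline{n-1}\xrightarrow{n-2}\cdots\xrightarrow{1}\bar1$. $G_2$: $1\xrightarrow{1}2\xrightarrow{2}3\xrightarrow{1}0\xrightarrow{1}\bar3\xrightarrow{2}\bar2\xrightarrow{1}\bar1$. For $B_n,C_n,D_n,G_2$ the weight of a letter is determined by $\langle\mathrm{wt}(x),\alpha_i^\vee\rangle=\varphi_i(x)-\varepsilon_i(x)$. Plactic congruence: $w\sim_\Gamma w'$ in $\Gamma^*$ iff there is an isomorphism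 of crystals from the connected component of $w$ to that of $w'$ sending $w$ to $w'$. Admissible columns: $\mathsf{Col}(\Gamma)_1\subset\Gamma^*$ is the union of the connected components in $\Gamma^*$ of the following highest weight words: $12\cdots p$ for $1\le p\le n$ in types $A_n,B_n,C_n$; $12\cdots p$ for $1\le p\le n$ and $12\cdots(n-1)\bar n$ in type $D_n$; $1$ and $12$ in type $G_2$. It is a crystal. Tableaux: identified with their column readings (columns right to left), tableaux are exactly the elements of $\mathsf{Col}(\Gamma)_1^*$ lying in the connected component (in the crystal $\mathsf{Col}(\Gamma)_1^*$) of a product, with nondecreasing lengths, of highest weight columns, i.e. of columns taken from the list: $12\cdots p$ ($1\le p\le n$) in types $A_n,B_n,C_n$; $12\cdots p$ ($1\le p\le n$) and $12\cdots(n-1)\bar n$ in type $D_n$; $1$ and $12$ in type $G_2$; where in type $D_n$ the columns $12\cdots n$ and $12\cdots(n-1)\bar n$ do not both occur. For each $w\in\Gamma^*$, $P_c(w)$ is the unique tableau whose underlying word in $\Gamma^*$ is $\sim_\Gamma$-equivalent to $w$; for a word in columns, $P_c$ is applied to its underlying word. Column presentation: the 2-polygraph $\mathsf{Col}(\Gamma)=(\mathsf{Col}(\Gamma)_1,\mathsf{Col}(\Gamma)_2)$, with one rule $c_1c_2\Rightarrow P_c(c_1c_2)$ for each $c_1,c_2\in\mathsf{Col}(\Gamma)_1$ with $c_1c_2\ne P_c(c_1c_2)$ in $\mathsf{Col}(\Gamma)_1^*$; $\mathsf{Col}(\Gamma)_2$ has the crystal structure inherited from the sources. It is finite, convergent,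 reduced, its source and target maps are crystal morphisms, it presents the plactic monoid $\Gamma^*/\sim_\Gamma$, and the normal form of a word $w$ in columns is $P_c(w)$. For $X=\mathsf{Col}(\Gamma)=(X_1,X_2)$: let $X_2^-=\{\alpha^-:t(\alpha)\Rightarrow s(\alpha)\mid\alpha\in X_2\}$ be the set of reversed rules. $X_2^\top$ is the (2,1)-monoid (2-category with one 0-cell and invertible 2-cells) with 1-cells $X_1^*$, whose 2-cells are identities and finite vertical composites ($\gamma_1\star_1\gamma_2$: first $\gamma_1$, then $\gamma_2$) of elements $t\alpha v$ with $\alpha\in X_2\sqcup X_2^-$, $t,v\in X_1^*$, modulo the congruence generated by $\alpha wv\star_1u'w\beta\equiv uw\beta\star_1\alpha wv'$ (for $\alpha:u\Rightarrow u'$, $\beta:v\Rightarrow v'$), $u\alpha v\star_1u\alpha^-v\equiv1$, $u\alpha^-v\star_1u\alpha v\equiv1$. On 2-cells: $k.\gamma=0$ if $k.s(\gamma)=0$; otherwise $k.1_u=1_{k.u}$, $k.\alpha^-=(k.\alpha)^-$, $k.(t\alpha v)$ is $(k.t)\alpha v$, $t(k.\alpha)v$ or $t\alpha(k.v)$ according to where $k$ acts on $ts(\alpha)v$, and $k.(\gamma_1\star_1\gamma_2)=(k.\gamma_1)\star_1(k.\gamma_2)$. A 2-sphere is a pair $(f,g)$ of 2-cells with the same source and the same target; $k.(f,g)=(k.f,k.g)$ if $k.s(f)\ne0$, and $0$ otherwise. A normalization strategy (for the normal form section $w\mapsto\widehat w$) assigns to each $u\in X_1^*$ a 2-cell $\sigma_u:u\Rightarrow\widehat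 u$ of $X_2^\top$ with $\sigma_{\widehat u}=1_{\widehat u}$; it is a crystal normalization strategy if $\sigma_{k.w}=k.\sigma_w$ whenever $k.w\ne0$. The critical branchings of $\mathsf{Col}(\Gamma)$ (minimal overlapping pairs of rewriting steps with common source) are, up to order of the entries, the pairs $(P_cc_3,c_1P_c)$ for $c_1,c_2,c_3$ as in the claim, and the coherent extension attached to $\sigma$ is the set of 2-spheres obtained by completing each of them with $\sigma$. *)

theory Defs
  imports Main
begin

section \<open>Crystals\<close>

text \<open>
  Partiality encodes the extra element 0: an operator value \<^term>\<open>None\<close> is the 0 of the
  literature. Indices are natural numbers; the operators with index outside the index set
  \<open>I\<close> of the simple roots are constantly \<^term>\<open>None\<close>. A weight is an integer vector, see
  \<open>letters\<close> below for the coordinates. All crystals are normal, so \<open>\<epsilon>\<close> and \<open>\<phi>\<close> are not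
  separate data but are read off from the operators.
\<close>

type_synonym weight = "nat \<Rightarrow> int"

record 'a crystal =
  elts :: "'a set"
  wt :: "'a \<Rightarrow> weight"
  ee :: "nat \<Rightarrow> 'a \<Rightarrow> 'a option"
  ff :: "nat \<Rightarrow> 'a \<Rightarrow> 'a option"

definition iter :: "('a \<Rightarrow> 'a option) \<Rightarrow> nat \<Rightarrow> 'a \<Rightarrow> 'a option" where
  "iter g n x = ((\<lambda>y. Option.bind y g) ^^ n) (Some x)"

definition eps :: "'a crystal \<Rightarrow> nat \<Rightarrow> 'a \<Rightarrow> nat" where
  "eps C i x = Max {n. iter (ee C i) n x \<noteq> None}"

definition phi :: "'a crystal \<Rightarrow> nat \<Rightarrow> 'a \<Rightarrow> nat" where
  "phi C i x = Max {n. iter (ff C i) n x \<noteq> None}"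

datatype kashiwara = E nat | F nat

fun act :: "'a crystal \<Rightarrow> kashiwara \<Rightarrow> 'a \<Rightarrow> 'a option" where
  "act C (E i) x = ee C i x"
| "act C (F i) x = ff C i x"

definition highest_weight :: "'a crystal \<Rightarrow> 'a \<Rightarrow> bool" where
  "highest_weight C x \<longleftrightarrow> x \<in> elts C \<and> (\<forall>i. ee C i x = None)"

definition component :: "'a crystal \<Rightarrow> 'a \<Rightarrow> 'a crystal" where
  "component C x = C\<lparr>elts := {y. (x, y) \<in> {(a, b). \<exists>k. act C k a = Some b}\<^sup>*}\<rparr>"

definition crystal_iso :: "'a crystal \<Rightarrow> 'b crystal \<Rightarrow> ('a \<Rightarrow> 'b) \<Rightarrow> bool" where
  "crystal_iso C D \<psi> \<longleftrightarrow> bij_betw \<psi> (elts C) (elts D) \<and>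
     (\<forall>x\<in>elts C. wt D (\<psi> x) = wt C x \<and>
        (\<forall>i. eps D i (\<psi> x) = eps C i x \<and> phi D i (\<psi> x) = phi C i x \<and>
             ee D i (\<psi> x) = map_option \<psi> (ee C i x) \<and>
             ff D i (\<psi> x) = map_option \<psi> (ff C i x)))"

definition tensor :: "'a crystal \<Rightarrow> 'b crystal \<Rightarrow> ('a \<times> 'b) crystal" where
  "tensor C D = \<lparr>
     elts = elts C \<times> elts D,
     wt = (\<lambda>(u, v) j. wt C u j + wt D v j),
     ee = (\<lambda>i (u, v). if phi C i u \<ge> eps D i v
                      then map_option (\<lambda>u'. (u', v)) (ee C i u)
                      else map_option (\<lambda>v'. (u, v')) (ee D i v)),
     ff = (\<lambda>i (u, v). if phi C i u > eps D i v
                      then map_option (\<lambda>u'. (u', v)) (ff C i u)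
                      else map_option (\<lambda>v'. (u, v')) (ff D i v))\<rparr>"

text \<open>
  The tensor power of exponent \<open>Suc n\<close> is the first letter tensored with the power of
  exponent \<open>n\<close>, transported from pairs to lists.
\<close>

primrec tensor_power :: "'a crystal \<Rightarrow> nat \<Rightarrow> 'a list crystal" where
  "tensor_power C 0 =
     \<lparr>elts = {[]}, wt = (\<lambda>_ _. 0), ee = (\<lambda>_ _. None), ff = (\<lambda>_ _. None)\<rparr>"
| "tensor_power C (Suc n) = (let T = tensor C (tensor_power C n); cons = (\<lambda>(x, w). x # w) in
     \<lparr>elts = cons ` elts T,
      wt = (\<lambda>w. wt T (hd w, tl w)),
      ee = (\<lambda>i w. map_option cons (ee T i (hd w, tl w))),
      ff = (\<lambda>i w. map_option cons (ff T i (hd w, tl w)))\<rparr>)"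

definition free_crystal :: "'a crystal \<Rightarrow> 'a list crystal" where
  "free_crystal C = \<lparr>
     elts = (\<Union>n. elts (tensor_power C n)),
     wt = (\<lambda>w. wt (tensor_power C (length w)) w),
     ee = (\<lambda>i w. ee (tensor_power C (length w)) i w),
     ff = (\<lambda>i w. ff (tensor_power C (length w)) i w)\<rparr>"


section \<open>Crystal bases of classical type\<close>

datatype cartan_type = TypeA nat | TypeB nat | TypeC nat | TypeD nat | TypeG2

fun classical_type :: "cartan_type \<Rightarrow> bool" where
  "classical_type (TypeA n) \<longleftrightarrow> n \<ge> 2"
| "classical_type (TypeB n) \<longleftrightarrow> n \<ge> 2"
| "classical_type (TypeC n) \<longleftrightarrow> n \<ge> 2"
| "classical_type (TypeD n) \<longleftrightarrow> n \<ge> 4"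
| "classical_type TypeG2 \<longleftrightarrow> True"

datatype letter = Pos nat | Zero | Bar nat

fun alphabet :: "cartan_type \<Rightarrow> letter set" where
  "alphabet (TypeA n) = Pos ` {1..n}"
| "alphabet (TypeB n) = Pos ` {1..n} \<union> {Zero} \<union> Bar ` {1..n}"
| "alphabet (TypeC n) = Pos ` {1..n} \<union> Bar ` {1..n}"
| "alphabet (TypeD n) = Pos ` {1..n} \<union> Bar ` {1..n}"
| "alphabet TypeG2 = Pos ` {1..3} \<union> {Zero} \<union> Bar ` {1..3}"

text \<open>\<open>arrow T i x y\<close> means that \<open>f\<^sub>i\<close> maps \<open>x\<close> to \<open>y\<close>.\<close>

fun arrow :: "cartan_type \<Rightarrow> nat \<Rightarrow> letter \<Rightarrow> letter \<Rightarrow> bool" where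
  "arrow (TypeA n) i x y \<longleftrightarrow> 1 \<le> i \<and> i < n \<and> x = Pos i \<and> y = Pos (i + 1)"
| "arrow (TypeB n) i x y \<longleftrightarrow>
     1 \<le> i \<and> i < n \<and> (x = Pos i \<and> y = Pos (i + 1) \<or> x = Bar (i + 1) \<and> y = Bar i) \<or>
     i = n \<and> (x = Pos n \<and> y = Zero \<or> x = Zero \<and> y = Bar n)"
| "arrow (TypeC n) i x y \<longleftrightarrow>
     1 \<le> i \<and> i < n \<and> (x = Pos i \<and> y = Pos (i + 1) \<or> x = Bar (i + 1) \<and> y = Bar i) \<or>
     i = n \<and> x = Pos n \<and> y = Bar n"
| "arrow (TypeD n) i x y \<longleftrightarrow>
     1 \<le> i \<and> i < n \<and> (x = Pos i \<and> y = Pos (i + 1) \<or> x = Bar (i + 1) \<and> y = Bar i) \<or>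
     i = n \<and> (x = Pos (n - 1) \<and> y = Bar n \<or> x = Pos n \<and> y = Bar (n - 1))"
| "arrow TypeG2 i x y \<longleftrightarrow>
     i = 1 \<and> (x = Pos 1 \<and> y = Pos 2 \<or> x = Pos 3 \<and> y = Zero \<or> x = Zero \<and> y = Bar 3 \<or>
              x = Bar 2 \<and> y = Bar 1) \<or>
     i = 2 \<and> (x = Pos 2 \<and> y = Pos 3 \<or> x = Bar 3 \<and> y = Bar 2)"

definition letter_e :: "cartan_type \<Rightarrow> nat \<Rightarrow> letter \<Rightarrow> letter option" where
  "letter_e T i y = (if \<exists>x. arrow T i x y then Some (THE x. arrow T i x y) else None)"

definition letter_f :: "cartan_type \<Rightarrow> nat \<Rightarrow> letter \<Rightarrow> letter option" where
  "letter_f T i x = (if \<exists>y. arrow T i x y then Some (THE y. arrow T i x y) else None)"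

text \<open>
  In type A the weight lives in \<open>\<int>\<^sup>n\<close>, with the \<open>j\<close>-th unit vector as weight of the letter
  \<open>j\<close>. In the other types the coordinates of a weight are its pairings with the simple
  coroots, so that the weight of a letter is the vector of the numbers \<open>\<phi>\<^sub>i - \<epsilon>\<^sub>i\<close>.
\<close>

fun letter_wt :: "cartan_type \<Rightarrow> letter \<Rightarrow> weight" where
  "letter_wt (TypeA n) x = (\<lambda>j. if x = Pos j then 1 else 0)"
| "letter_wt T x = (\<lambda>i. int (Max {n. iter (letter_f T i) n x \<noteq> None})
                       - int (Max {n. iter (letter_e T i) n x \<noteq> None}))"

definition letters :: "cartan_type \<Rightarrow> letter crystal" where
  "letters T = \<lparr>elts = alphabet T, wt = letter_wt T, ee = letter_e T, ff = letter_f T\<rparr>"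

definition words :: "cartan_type \<Rightarrow> letter list crystal" where
  "words T = free_crystal (letters T)"

definition plactic :: "cartan_type \<Rightarrow> letter list \<Rightarrow> letter list \<Rightarrow> bool" where
  "plactic T w w' \<longleftrightarrow> w \<in> elts (words T) \<and> w' \<in> elts (words T) \<and>
     (\<exists>\<psi>. crystal_iso (component (words T) w) (component (words T) w') \<psi> \<and> \<psi> w = w')"


section \<open>Columns and tableaux\<close>

type_synonym column = "letter list"

definition init_column :: "nat \<Rightarrow> column" where
  "init_column p = map Pos [1..<Suc p]"

definition bar_column :: "nat \<Rightarrow> column" where
  "bar_column n = map Pos [1..<n] @ [Bar n]"

fun hw_columns :: "cartan_type \<Rightarrow> column set" where
  "hw_columns (TypeA n) = init_column ` {1..n}"
| "hw_columns (TypeB n) = init_column ` {1..n}"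
| "hw_columns (TypeC n) = init_column ` {1..n}"
| "hw_columns (TypeD n) = init_column ` {1..n} \<union> {bar_column n}"
| "hw_columns TypeG2 = {init_column 1, init_column 2}"

text \<open>
  A column is a word, so the crystal of columns is a union of components of the crystal of
  words, and \<open>free_crystal (columns T)\<close> is the crystal of words in columns; the underlying
  word of a word in columns is obtained with \<^const>\<open>concat\<close>.
\<close>

definition columns :: "cartan_type \<Rightarrow> column crystal" where
  "columns T = (words T)\<lparr>elts := (\<Union>c\<in>hw_columns T. elts (component (words T) c))\<rparr>"

fun compatible :: "cartan_type \<Rightarrow> column list \<Rightarrow> bool" where
  "compatible (TypeD n) h \<longleftrightarrow> \<not> (init_column n \<in> set h \<and> bar_column n \<in> set h)"
| "compatible T h \<longleftrightarrow> True"

definition hw_tableaux :: "cartan_type \<Rightarrow> column list set" where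
  "hw_tableaux T = {h \<in> lists (hw_columns T). sorted (map length h) \<and> compatible T h}"

definition tableaux :: "cartan_type \<Rightarrow> column list set" where
  "tableaux T = (\<Union>h\<in>hw_tableaux T. elts (component (free_crystal (columns T)) h))"

text \<open>
  \<open>Pc T w\<close> is the unique tableau whose underlying word is plactically equivalent to \<open>w\<close>. That
  such a tableau exists and is unique for every word is a theorem on crystals, not part of
  the definition, hence the option type.
\<close>

definition Pc :: "cartan_type \<Rightarrow> letter list \<Rightarrow> column list option" where
  "Pc T w = (if \<exists>!t. t \<in> tableaux T \<and> plactic T (concat t) w
             then Some (THE t. t \<in> tableaux T \<and> plactic T (concat t) w) else None)"


section \<open>The (2,1)-monoid of a 2-polygraph\<close>

text \<open>
  A rule is identified with the pair of its source and target, as no two rules of the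
  column presentation are parallel.
\<close>

type_synonym 'a rule = "'a list \<times> 'a list"

record 'a polygraph =
  gens :: "'a set"
  rules :: "'a rule set"

datatype 'a srule = Fwd "'a rule" | Rev "'a rule"

fun rule_src :: "'a srule \<Rightarrow> 'a list" where
  "rule_src (Fwd \<alpha>) = fst \<alpha>"
| "rule_src (Rev \<alpha>) = snd \<alpha>"

fun rule_tgt :: "'a srule \<Rightarrow> 'a list" where
  "rule_tgt (Fwd \<alpha>) = snd \<alpha>"
| "rule_tgt (Rev \<alpha>) = fst \<alpha>"

fun rule_inv :: "'a srule \<Rightarrow> 'a srule" where
  "rule_inv (Fwd \<alpha>) = Rev \<alpha>"
| "rule_inv (Rev \<alpha>) = Fwd \<alpha>"

definition signed_rules :: "'a polygraph \<Rightarrow> 'a srule set" where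
  "signed_rules X = Fwd ` rules X \<union> Rev ` rules X"

text \<open>The triple \<open>(t, \<alpha>, v)\<close> stands for the whiskered rule \<open>t\<alpha>v\<close>.\<close>

type_synonym 'a step = "'a list \<times> 'a srule \<times> 'a list"

fun step_src :: "'a step \<Rightarrow> 'a list" where
  "step_src (t, \<alpha>, v) = t @ rule_src \<alpha> @ v"

fun step_tgt :: "'a step \<Rightarrow> 'a list" where
  "step_tgt (t, \<alpha>, v) = t @ rule_tgt \<alpha> @ v"

definition steps :: "'a polygraph \<Rightarrow> 'a step set" where
  "steps X = lists (gens X) \<times> signed_rules X \<times> lists (gens X)"

text \<open>
  A formal composite is its source together with the list of its steps, in the order in
  which they are applied; the empty list gives the identities.
\<close>

type_synonym 'a composite = "'a list \<times> 'a step list"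

fun path_from :: "'a polygraph \<Rightarrow> 'a list \<Rightarrow> 'a step list \<Rightarrow> bool" where
  "path_from X u [] \<longleftrightarrow> u \<in> lists (gens X)"
| "path_from X u (s # ss) \<longleftrightarrow> s \<in> steps X \<and> step_src s = u \<and> path_from X (step_tgt s) ss"

definition composites :: "'a polygraph \<Rightarrow> 'a composite set" where
  "composites X = {(u, ss). path_from X u ss}"

definition composite_tgt :: "'a composite \<Rightarrow> 'a list" where
  "composite_tgt p = (if snd p = [] then fst p else step_tgt (last (snd p)))"

text \<open>
  The rule \<open>inverse\<close> covers both inverse laws, as \<open>\<alpha>\<close> ranges over rules and reversed rules.
\<close>

inductive congr :: "'a polygraph \<Rightarrow> 'a composite \<Rightarrow> 'a composite \<Rightarrow> bool" for X where
  refl: "p \<in> composites X \<Longrightarrow> congr X p p"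
| sym: "congr X p q \<Longrightarrow> congr X q p"
| trans: "congr X p q \<Longrightarrow> congr X q r \<Longrightarrow> congr X p r"
| exchange:
    "(s, xs @ [(t, \<alpha>, w @ rule_src \<beta> @ v), (t @ rule_tgt \<alpha> @ w, \<beta>, v)] @ ys) \<in> composites X \<Longrightarrow>
     congr X (s, xs @ [(t, \<alpha>, w @ rule_src \<beta> @ v), (t @ rule_tgt \<alpha> @ w, \<beta>, v)] @ ys)
             (s, xs @ [(t @ rule_src \<alpha> @ w, \<beta>, v), (t, \<alpha>, w @ rule_tgt \<beta> @ v)] @ ys)"
| inverse:
    "(s, xs @ [(t, \<alpha>, v), (t, rule_inv \<alpha>, v)] @ ys) \<in> composites X \<Longrightarrow>
     congr X (s, xs @ [(t, \<alpha>, v), (t, rule_inv \<alpha>, v)] @ ys) (s, xs @ ys)"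

definition congr_rel :: "'a polygraph \<Rightarrow> ('a composite \<times> 'a composite) set" where
  "congr_rel X = {(p, q). congr X p q}"

type_synonym 'a cell = "'a composite set"

definition cells :: "'a polygraph \<Rightarrow> 'a cell set" where
  "cells X = composites X // congr_rel X"

text \<open>All representatives of a 2-cell have the same source and the same target.\<close>

definition cell_src :: "'a cell \<Rightarrow> 'a list" where
  "cell_src \<gamma> = fst (SOME p. p \<in> \<gamma>)"

definition cell_tgt :: "'a cell \<Rightarrow> 'a list" where
  "cell_tgt \<gamma> = composite_tgt (SOME p. p \<in> \<gamma>)"

definition id_cell :: "'a polygraph \<Rightarrow> 'a list \<Rightarrow> 'a cell" where
  "id_cell X u = congr_rel X `` {(u, [])}"

definition step_cell :: "'a polygraph \<Rightarrow> 'a step \<Rightarrow> 'a cell" where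
  "step_cell X s = congr_rel X `` {(step_src s, [s])}"

definition vcomp :: "'a polygraph \<Rightarrow> 'a cell \<Rightarrow> 'a cell \<Rightarrow> 'a cell" where
  "vcomp X \<gamma> \<delta> = congr_rel X `` {(u, ss @ ts) | u ss v ts. (u, ss) \<in> \<gamma> \<and> (v, ts) \<in> \<delta>}"

type_synonym 'a sphere = "'a cell \<times> 'a cell"

definition two_spheres :: "'a polygraph \<Rightarrow> 'a sphere set" where
  "two_spheres X = {(f, g). f \<in> cells X \<and> g \<in> cells X \<and>
                      cell_src f = cell_src g \<and> cell_tgt f = cell_tgt g}"


section \<open>Kashiwara operators on 2-cells\<close>

text \<open>In this section \<open>C\<close> is a crystal structure on the generators of \<open>X\<close>.\<close>

definition act_rule ::
  "'a crystal \<Rightarrow> 'a polygraph \<Rightarrow> kashiwara \<Rightarrow> 'a rule \<Rightarrow> 'a rule option" where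
  "act_rule C X k \<alpha> =
     map_option (\<lambda>s. (s, THE t. (s, t) \<in> rules X)) (act (free_crystal C) k (fst \<alpha>))"

fun act_srule ::
  "'a crystal \<Rightarrow> 'a polygraph \<Rightarrow> kashiwara \<Rightarrow> 'a srule \<Rightarrow> 'a srule option" where
  "act_srule C X k (Fwd \<alpha>) = map_option Fwd (act_rule C X k \<alpha>)"
| "act_srule C X k (Rev \<alpha>) = map_option Rev (act_rule C X k \<alpha>)"

text \<open>
  A Kashiwara operator changes a word in exactly one position; the case distinction is
  on the factor of the source of the step that contains this position.
\<close>

fun act_step ::
  "'a crystal \<Rightarrow> 'a polygraph \<Rightarrow> kashiwara \<Rightarrow> 'a step \<Rightarrow> 'a step option" where
  "act_step C X k (t, \<alpha>, v) =
     (let kk = act (free_crystal C) k; s = rule_src \<alpha> in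
      if kk (t @ s @ v) = None then None
      else if kk (t @ s @ v) = map_option (\<lambda>t'. t' @ s @ v) (kk t)
        then map_option (\<lambda>t'. (t', \<alpha>, v)) (kk t)
      else if kk (t @ s @ v) = map_option (\<lambda>s'. t @ s' @ v) (kk s)
        then map_option (\<lambda>\<alpha>'. (t, \<alpha>', v)) (act_srule C X k \<alpha>)
      else map_option (\<lambda>v'. (t, \<alpha>, v')) (kk v))"

definition act_composite ::
  "'a crystal \<Rightarrow> 'a polygraph \<Rightarrow> kashiwara \<Rightarrow> 'a composite \<Rightarrow> 'a composite option" where
  "act_composite C X k p =
     map_option (\<lambda>u. (u, map (the \<circ> act_step C X k) (snd p))) (act (free_crystal C) k (fst p))"

definition act_cell ::
  "'a crystal \<Rightarrow> 'a polygraph \<Rightarrow> kashiwara \<Rightarrow> 'a cell \<Rightarrow> 'a cell option" where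
  "act_cell C X k \<gamma> =
     (if act (free_crystal C) k (cell_src \<gamma>) = None then None
      else Some (congr_rel X `` {q. \<exists>p\<in>\<gamma>. act_composite C X k p = Some q}))"

definition act_sphere ::
  "'a crystal \<Rightarrow> 'a polygraph \<Rightarrow> kashiwara \<Rightarrow> 'a sphere \<Rightarrow> 'a sphere option" where
  "act_sphere C X k S =
     (if act (free_crystal C) k (cell_src (fst S)) = None then None
      else Some (the (act_cell C X k (fst S)), the (act_cell C X k (snd S))))"


section \<open>The column presentation and its coherent extension\<close>

definition Col :: "cartan_type \<Rightarrow> column polygraph" where
  "Col T = \<lparr>gens = elts (columns T),
            rules = {([c1, c2], t) | c1 c2 t. c1 \<in> elts (columns T) \<and> c2 \<in> elts (columns T) \<and>
                       Pc T (c1 @ c2) = Some t \<and> t \<noteq> [c1, c2]}\<rparr>"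

text \<open>
  The normal form of a word \<open>u\<close> in columns is the tableau \<open>Pc T (concat u)\<close>; the first
  conjunct says that \<open>\<sigma> u\<close> is a 2-cell from \<open>u\<close> to this normal form.
\<close>

definition normalization_strategy :: "cartan_type \<Rightarrow> (column list \<Rightarrow> column cell) \<Rightarrow> bool" where
  "normalization_strategy T \<sigma> \<longleftrightarrow>
     (\<forall>u\<in>lists (gens (Col T)).
        \<sigma> u \<in> cells (Col T) \<and> cell_src (\<sigma> u) = u \<and> Pc T (concat u) = Some (cell_tgt (\<sigma> u))) \<and>
     (\<forall>u\<in>lists (gens (Col T)). \<forall>n. Pc T (concat u) = Some n \<longrightarrow> \<sigma> n = id_cell (Col T) n)"

definition crystal_normalization_strategy ::
  "cartan_type \<Rightarrow> (column list \<Rightarrow> column cell) \<Rightarrow> bool" where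
  "crystal_normalization_strategy T \<sigma> \<longleftrightarrow> normalization_strategy T \<sigma> \<and>
     (\<forall>k. \<forall>u\<in>lists (gens (Col T)). \<forall>u'. act (free_crystal (columns T)) k u = Some u' \<longrightarrow>
        act_cell (columns T) (Col T) k (\<sigma> u) = Some (\<sigma> u'))"

definition left_step :: "cartan_type \<Rightarrow> column \<Rightarrow> column \<Rightarrow> column \<Rightarrow> column step" where
  "left_step T c1 c2 c3 = ([], Fwd ([c1, c2], the (Pc T (c1 @ c2))), [c3])"

definition right_step :: "cartan_type \<Rightarrow> column \<Rightarrow> column \<Rightarrow> column \<Rightarrow> column step" where
  "right_step T c1 c2 c3 = ([c1], Fwd ([c2, c3], the (Pc T (c2 @ c3))), [])"

definition gamma ::
  "cartan_type \<Rightarrow> (column list \<Rightarrow> column cell) \<Rightarrow> column \<Rightarrow> column \<Rightarrow> column \<Rightarrow> column sphere"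
where
  "gamma T \<sigma> c1 c2 c3 =
     (vcomp (Col T) (step_cell (Col T) (left_step T c1 c2 c3))
        (\<sigma> (the (Pc T (c1 @ c2)) @ [c3])),
      vcomp (Col T) (step_cell (Col T) (right_step T c1 c2 c3))
        (\<sigma> (c1 # the (Pc T (c2 @ c3)))))"

definition critical :: "cartan_type \<Rightarrow> column \<Rightarrow> column \<Rightarrow> column \<Rightarrow> bool" where
  "critical T c1 c2 c3 \<longleftrightarrow> c1 \<in> elts (columns T) \<and> c2 \<in> elts (columns T) \<and> c3 \<in> elts (columns T) \<and>
     Pc T (c1 @ c2) \<noteq> Some [c1, c2] \<and> Pc T (c2 @ c3) \<noteq> Some [c2, c3]"

definition coherent_extension ::
  "cartan_type \<Rightarrow> (column list \<Rightarrow> column cell) \<Rightarrow> column sphere set" where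
  "coherent_extension T \<sigma> = {gamma T \<sigma> c1 c2 c3 | c1 c2 c3. critical T c1 c2 c3}"

definition hw_coherent_extension ::
  "cartan_type \<Rightarrow> (column list \<Rightarrow> column cell) \<Rightarrow> column sphere set" where
  "hw_coherent_extension T \<sigma> = {gamma T \<sigma> c1 c2 c3 | c1 c2 c3.
     critical T c1 c2 c3 \<and> highest_weight (free_crystal (columns T)) [c1, c2, c3]}"

end

theory Submission
  imports Defs
begin

text \<open>
  The tensor rule for a concatenation of words involves only the numbers \<open>\<epsilon>\<^sub>i\<close> and \<open>\<phi>\<^sub>i\<close> of the
  factors. The two sides of a rule are plactically equivalent, hence have the same numbers, so a
  Kashiwara operator acts in the same place before and after a rewriting step. Therefore it
  respects the exchange and inverse laws, and with the equivariance of the strategy it sends the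
  sphere of \<open>c\<^sub>1c\<^sub>2c\<^sub>3\<close> to the sphere of the image of \<open>c\<^sub>1c\<^sub>2c\<^sub>3\<close>. Criticality is preserved as well, and
  the \<open>e\<^sub>i\<close> terminate because the crystal graph of the letters is graded by height; so raising
  \<open>c\<^sub>1c\<^sub>2c\<^sub>3\<close> to a highest weight word and applying the inverse \<open>f\<^sub>i\<close> to its sphere gives the claim.
\<close>

section \<open>Crystals with finite strings\<close>

text \<open>The obstacle is that the operators on 2-cells are computed on formal composites, step by
  step, and each step decides for itself where the operator acts. The decisions must agree along a
  composite, for the images to be composable, and across each generating relation, for congruent
  composites to stay congruent. Moreover \<open>act_step\<close> finds the place by comparing words,
  not by the tensor rule; the two agree because an operator never fixes a word. All of this needs
  \<open>eps\<close> and \<open>phi\<close>, given as \<open>Max\<close> of a set of exponents, to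
  be meaningful, so finiteness of strings comes first. The same tensor rule is applied to letters,
  to words and to columns taken as letters. It is therefore proved for a class of crystals that is
  closed under \<open>free_crystal\<close>, namely those whose operators are mutually inverse and
  strictly decrease a rank. That an operator carries rules to rules has two reasons: the sides stay
  distinct because the operators are injective, and the new target is a normal form because the
  tableaux are a union of components.\<close>

lemma iter_0 [simp]: "iter g 0 x = Some x"
  by (simp add: iter_def)

lemma iter_bind_None:
  fixes g :: "'a \<Rightarrow> 'a option"
  shows "((\<lambda>y. Option.bind y g) ^^ n) None = None"
  by (induction n) auto

lemma iter_Suc: "iter g (Suc n) x = (case g x of None \<Rightarrow> None | Some y \<Rightarrow> iter g n y)"
  unfolding iter_def
  by (simp add: funpow_Suc_right iter_bind_None split: option.split del: funpow.simps(2))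

text \<open>A function that drops by one with each application, and vanishes exactly where
  \<open>g\<close> stops, counts the defined iterates. The set \<open>S\<close> accommodates tensor
  powers, whose operators are understood only on words of the right length.\<close>

lemma Max_iter:
  assumes closed: "\<And>x y. x \<in> S \<Longrightarrow> g x = Some y \<Longrightarrow> y \<in> S"
    and None: "\<And>x. x \<in> S \<Longrightarrow> g x = None \<longleftrightarrow> m x = 0"
    and Some: "\<And>x y. x \<in> S \<Longrightarrow> g x = Some y \<Longrightarrow> m x = Suc (m y)"
    and "x \<in> S"
  shows "Max {n. iter g n x \<noteq> None} = m x"
proof -
  have "iter g n x \<noteq> None \<longleftrightarrow> n \<le> m x" for n
    using \<open>x \<in> S\<close>
  proof (induction n arbitrary: x)
    case (Suc n)
    show ?case
      using Suc.prems None[of x] Some[of x] closed[of x] Suc.IH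
      by (cases "g x") (auto simp: iter_Suc)
  qed simp
  then have "{n. iter g n x \<noteq> None} = {..m x}" by auto
  then show ?thesis
    by (simp add: Max_eq_iff)
qed

lemma Max_iter_None:
  assumes "g x = None"
  shows "Max {n. iter g n x \<noteq> None} = 0"
proof -
  have "iter g n x \<noteq> None \<longleftrightarrow> n = 0" for n
    using assms by (cases n) (auto simp: iter_Suc)
  then have "{n. iter g n x \<noteq> None} = {0}" by auto
  then show ?thesis by simp
qed

text \<open>The rank bounds the exponents, so \<open>Max\<close> is taken over a finite set; the
  exponents at \<open>x\<close> are 0 and the successors of those at \<open>y\<close>.\<close>

lemma Max_iter_Some:
  fixes r :: "'a \<Rightarrow> nat"
  assumes r: "\<And>x y. g x = Some y \<Longrightarrow> r y < r x" and "g x = Some y"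
  shows "Max {n. iter g n x \<noteq> None} = Suc (Max {n. iter g n y \<noteq> None})"
proof -
  have "iter g n x \<noteq> None \<Longrightarrow> n \<le> r x" for n x
  proof (induction n arbitrary: x)
    case (Suc n)
    then show ?case using r[of x] by (fastforce simp: iter_Suc split: option.splits)
  qed simp
  then have "{n. iter g n y \<noteq> None} \<subseteq> {..r y}" by auto
  then have fin: "finite {n. iter g n y \<noteq> None}" by (rule finite_subset) simp
  have ne: "0 \<in> {n. iter g n y \<noteq> None}" by simp
  have "n \<in> {n. iter g n x \<noteq> None} \<longleftrightarrow> n \<in> insert 0 (Suc ` {n. iter g n y \<noteq> None})" for n
    using assms(2) by (cases n) (auto simp: iter_Suc)
  then have "{n. iter g n x \<noteq> None} = insert 0 (Suc ` {n. iter g n y \<noteq> None})" by blast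
  then show ?thesis
    using fin ne mono_Max_commute[OF mono_Suc fin] Max_insert[of "Suc ` {n. iter g n y \<noteq> None}" 0]
    by (metis empty_iff finite_imageI image_is_empty max_0L)
qed

text \<open>The ranks are uniform in the index: for one index they bound the strings, for all
  indices together they make raising to a highest weight element terminate. They are quantified
  inside the axioms so that \<open>free_crystal C\<close>, with ranks of its own, is again an
  instance.\<close>

locale ranked_crystal =
  fixes C :: "'a crystal"
  assumes ff_iff_ee: "ff C i x = Some y \<longleftrightarrow> ee C i y = Some x"
    and ee_rank: "\<exists>r :: 'a \<Rightarrow> nat. \<forall>i x y. ee C i x = Some y \<longrightarrow> r y < r x"
    and ff_rank: "\<exists>r :: 'a \<Rightarrow> nat. \<forall>i x y. ff C i x = Some y \<longrightarrow> r y < r x"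
begin

lemma eps_Some: "ee C i x = Some y \<Longrightarrow> eps C i x = Suc (eps C i y)"
proof -
  obtain r :: "'a \<Rightarrow> nat" where "\<forall>i x y. ee C i x = Some y \<longrightarrow> r y < r x" using ee_rank by blast
  then show "ee C i x = Some y \<Longrightarrow> eps C i x = Suc (eps C i y)"
    unfolding eps_def by (intro Max_iter_Some[where r = r]) auto
qed

lemma phi_Some: "ff C i x = Some y \<Longrightarrow> phi C i x = Suc (phi C i y)"
proof -
  obtain r :: "'a \<Rightarrow> nat" where "\<forall>i x y. ff C i x = Some y \<longrightarrow> r y < r x" using ff_rank by blast
  then show "ff C i x = Some y \<Longrightarrow> phi C i x = Suc (phi C i y)"
    unfolding phi_def by (intro Max_iter_Some[where r = r]) auto
qed

lemma ee_None_iff: "ee C i x = None \<longleftrightarrow> eps C i x = 0"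
  using Max_iter_None[of "ee C i" x] eps_Some[of i x]
  by (cases "ee C i x") (auto simp: eps_def)

lemma ff_None_iff: "ff C i x = None \<longleftrightarrow> phi C i x = 0"
  using Max_iter_None[of "ff C i" x] phi_Some[of i x]
  by (cases "ff C i x") (auto simp: phi_def)

lemma act_neq: "act C k x \<noteq> Some x"
proof (cases k)
  case (E i)
  then show ?thesis using eps_Some[of i x x] by auto
next
  case (F i)
  then show ?thesis using phi_Some[of i x x] by auto
qed

end


section \<open>Words over a crystal\<close>

lemma elts_tensor_power: "elts (tensor_power C n) = {w \<in> lists (elts C). length w = n}"
proof (induction n)
  case (Suc n)
  show ?case
  proof (intro set_eqI iffI)
    fix w assume "w \<in> {w \<in> lists (elts C). length w = Suc n}"
    then obtain x v where "w = x # v" "x \<in> elts C" "v \<in> lists (elts C)" "length v = n"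
      by (cases w) auto
    then show "w \<in> elts (tensor_power C (Suc n))"
      using Suc by (auto simp: tensor_def Let_def image_iff)
  qed (use Suc in \<open>auto simp: tensor_def Let_def\<close>)
qed auto

lemma elts_free_crystal: "elts (free_crystal C) = lists (elts C)"
  by (auto simp: free_crystal_def elts_tensor_power)

lemma wt_free_Nil: "wt (free_crystal C) [] = (\<lambda>_. 0)"
  by (simp add: free_crystal_def)

lemma wt_free_Cons: "wt (free_crystal C) (x # w) = (\<lambda>j. wt C x j + wt (free_crystal C) w j)"
  by (simp add: free_crystal_def tensor_def Let_def)

lemma wt_free_append:
  "wt (free_crystal C) (u @ v) = (\<lambda>j. wt (free_crystal C) u j + wt (free_crystal C) v j)"
  by (induction u) (auto simp: wt_free_Nil wt_free_Cons add.assoc)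

text \<open>
  The truncated subtractions cancel \<open>\<phi>\<close> of a letter against \<open>\<epsilon>\<close> of the word to its right.
\<close>

primrec word_eps :: "'a crystal \<Rightarrow> nat \<Rightarrow> 'a list \<Rightarrow> nat" where
  "word_eps C i [] = 0"
| "word_eps C i (x # w) = eps C i x + (word_eps C i w - phi C i x)"

primrec word_phi :: "'a crystal \<Rightarrow> nat \<Rightarrow> 'a list \<Rightarrow> nat" where
  "word_phi C i [] = 0"
| "word_phi C i (x # w) = word_phi C i w + (phi C i x - word_eps C i w)"

primrec word_ee :: "'a crystal \<Rightarrow> nat \<Rightarrow> 'a list \<Rightarrow> 'a list option" where
  "word_ee C i [] = None"
| "word_ee C i (x # w) = (if word_eps C i w \<le> phi C i x
     then map_option (\<lambda>x'. x' # w) (ee C i x)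
     else map_option (\<lambda>w'. x # w') (word_ee C i w))"

primrec word_ff :: "'a crystal \<Rightarrow> nat \<Rightarrow> 'a list \<Rightarrow> 'a list option" where
  "word_ff C i [] = None"
| "word_ff C i (x # w) = (if word_eps C i w < phi C i x
     then map_option (\<lambda>x'. x' # w) (ff C i x)
     else map_option (\<lambda>w'. x # w') (word_ff C i w))"

context ranked_crystal
begin

lemma word_ee_None_iff: "word_ee C i w = None \<longleftrightarrow> word_eps C i w = 0"
  by (induction w) (auto simp: ee_None_iff)

lemma word_ff_None_iff: "word_ff C i w = None \<longleftrightarrow> word_phi C i w = 0"
  by (induction w) (auto simp: ff_None_iff)

text \<open>The tests with \<open>\<le>\<close> for raising and \<open><\<close> for lowering fit
  together: raising increases \<open>phi\<close> of the left letter by one or decreases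
  \<open>word_eps\<close> of the rest by one, and either change makes the lowering test choose the
  same letter again.\<close>

lemma word_ee_Some:
  "word_ee C i w = Some y \<Longrightarrow> word_eps C i w = Suc (word_eps C i y) \<and>
     word_phi C i y = Suc (word_phi C i w) \<and> word_ff C i y = Some w \<and> length y = length w"
proof (induction w arbitrary: y)
  case (Cons x w)
  show ?case
  proof (cases "word_eps C i w \<le> phi C i x")
    case True
    then obtain x' where x': "ee C i x = Some x'" "y = x' # w" using Cons.prems by auto
    then have f: "ff C i x' = Some x" by (simp add: ff_iff_ee)
    show ?thesis using x' f True eps_Some[OF x'(1)] phi_Some[OF f] by auto
  next
    case False
    then obtain w' where w': "word_ee C i w = Some w'" "y = x # w'" using Cons.prems by auto
    show ?thesis using w' False Cons.IH[OF w'(1)] by auto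
  qed
qed simp

lemma word_ff_Some:
  "word_ff C i w = Some y \<Longrightarrow> word_phi C i w = Suc (word_phi C i y) \<and>
     word_eps C i y = Suc (word_eps C i w) \<and> word_ee C i y = Some w \<and> length y = length w"
proof (induction w arbitrary: y)
  case (Cons x w)
  show ?case
  proof (cases "word_eps C i w < phi C i x")
    case True
    then obtain x' where x': "ff C i x = Some x'" "y = x' # w" using Cons.prems by auto
    then have e: "ee C i x' = Some x" by (simp add: ff_iff_ee)
    show ?thesis using x' e True eps_Some[OF e] phi_Some[OF x'(1)] by auto
  next
    case False
    then obtain w' where w': "word_ff C i w = Some w'" "y = x # w'" using Cons.prems by auto
    show ?thesis using w' False Cons.IH[OF w'(1)] by auto
  qed
qed simp

lemma tensor_power_ops:
  "length w = n \<Longrightarrow> ee (tensor_power C n) i w = word_ee C i w \<and> ff (tensor_power C n) i w = word_ff C i w"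
proof (induction n arbitrary: w)
  case (Suc n)
  obtain x v where w: "w = x # v" "length v = n" using Suc.prems by (cases w) auto
  \<comment> \<open>The tensor rule refers to \<open>eps\<close> of the tensor power, a maximum over
    iterates, while the induction hypothesis speaks of words of length \<open>n\<close> only.
    Raising preserves the length, so \<open>Max_iter\<close> applies on that set.\<close>
  have eps: "eps (tensor_power C n) i v = word_eps C i v"
    unfolding eps_def
  proof (rule Max_iter[where S = "{v. length v = n}"])
    fix v y assume v: "v \<in> {v. length v = n}" and e: "ee (tensor_power C n) i v = Some y"
    then have "word_ee C i v = Some y" using Suc.IH[of v] by simp
    then show "y \<in> {v. length v = n}" "word_eps C i v = Suc (word_eps C i y)"
      using word_ee_Some[of i v y] v by simp_all
  qed (use w Suc.IH word_ee_None_iff in auto)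
  show ?case
    using w eps Suc.IH[OF w(2)]
    by (simp add: tensor_def Let_def option.map_comp comp_def)
qed simp

lemma free_ee: "ee (free_crystal C) i w = word_ee C i w"
  by (simp add: free_crystal_def tensor_power_ops)

lemma free_ff: "ff (free_crystal C) i w = word_ff C i w"
  by (simp add: free_crystal_def tensor_power_ops)

lemma free_eps: "eps (free_crystal C) i w = word_eps C i w"
  unfolding eps_def free_ee[abs_def]
  by (rule Max_iter[where S = UNIV]) (auto simp: word_ee_None_iff dest: word_ee_Some)

lemma free_phi: "phi (free_crystal C) i w = word_phi C i w"
  unfolding phi_def free_ff[abs_def]
  by (rule Max_iter[where S = UNIV]) (auto simp: word_ff_None_iff dest: word_ff_Some)

text \<open>An operator replaces a single letter, by one of smaller rank, so the sum of the ranks of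
  the letters decreases.\<close>

lemma word_ee_rank:
  "(\<And>x y. ee C i x = Some y \<Longrightarrow> r y < r x) \<Longrightarrow> word_ee C i w = Some v \<Longrightarrow>
     sum_list (map r v) < (sum_list (map r w) :: nat)"
  by (induction w arbitrary: v) (auto split: if_splits)

lemma word_ff_rank:
  "(\<And>x y. ff C i x = Some y \<Longrightarrow> r y < r x) \<Longrightarrow> word_ff C i w = Some v \<Longrightarrow>
     sum_list (map r v) < (sum_list (map r w) :: nat)"
  by (induction w arbitrary: v) (auto split: if_splits)

lemma ranked_free_crystal: "ranked_crystal (free_crystal C)"
proof
  show "ff (free_crystal C) i x = Some y \<longleftrightarrow> ee (free_crystal C) i y = Some x" for i x y
    by (auto simp: free_ee free_ff dest: word_ee_Some word_ff_Some)
  obtain r :: "'a \<Rightarrow> nat" where "\<forall>i x y. ee C i x = Some y \<longrightarrow> r y < r x" using ee_rank by blast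
  then show "\<exists>r :: 'a list \<Rightarrow> nat. \<forall>i x y. ee (free_crystal C) i x = Some y \<longrightarrow> r y < r x"
    by (intro exI[of _ "\<lambda>w. sum_list (map r w)"]) (auto simp: free_ee intro: word_ee_rank)
  obtain r :: "'a \<Rightarrow> nat" where "\<forall>i x y. ff C i x = Some y \<longrightarrow> r y < r x" using ff_rank by blast
  then show "\<exists>r :: 'a list \<Rightarrow> nat. \<forall>i x y. ff (free_crystal C) i x = Some y \<longrightarrow> r y < r x"
    by (intro exI[of _ "\<lambda>w. sum_list (map r w)"]) (auto simp: free_ff intro: word_ff_rank)
qed

end

text \<open>The cancellation of \<open>phi\<close> on the left against \<open>eps\<close> on the
  right is associative. The two formulas go through one induction because the step for
  \<open>word_phi\<close> uses the formula for \<open>word_eps\<close>.\<close>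

lemma word_eps_append:
  "word_eps C i (u @ v) = word_eps C i u + (word_eps C i v - word_phi C i u)"
  and word_phi_append:
  "word_phi C i (u @ v) = word_phi C i v + (word_phi C i u - word_eps C i v)"
proof -
  have "word_eps C i (u @ v) = word_eps C i u + (word_eps C i v - word_phi C i u) \<and>
    word_phi C i (u @ v) = word_phi C i v + (word_phi C i u - word_eps C i v)"
    by (induction u) auto
  then show "word_eps C i (u @ v) = word_eps C i u + (word_eps C i v - word_phi C i u)"
    "word_phi C i (u @ v) = word_phi C i v + (word_phi C i u - word_eps C i v)"
    by blast+
qed

primrec acts_left :: "'a crystal \<Rightarrow> kashiwara \<Rightarrow> 'a list \<Rightarrow> 'a list \<Rightarrow> bool" where
  "acts_left C (E i) u v \<longleftrightarrow> word_eps C i v \<le> word_phi C i u"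
| "acts_left C (F i) u v \<longleftrightarrow> word_eps C i v < word_phi C i u"

text \<open>Associativity of the tensor rule. It compares the tests for the composite whisker
  \<open>t @ x @ w\<close> with those for its factors in \<open>exchange_image\<close>.\<close>

lemma acts_left_append_left:
  "acts_left C k (u @ v) w \<longleftrightarrow> acts_left C k u (v @ w) \<or> acts_left C k v w"
  by (cases k) (auto simp: word_eps_append word_phi_append)

text \<open>These numbers are all that the tensor rule sees of a factor, so words related in this
  way are interchangeable in every test.\<close>

definition same_strings :: "'a crystal \<Rightarrow> 'a list \<Rightarrow> 'a list \<Rightarrow> bool" where
  "same_strings C u v \<longleftrightarrow> (\<forall>i. word_eps C i u = word_eps C i v \<and> word_phi C i u = word_phi C i v)"

lemma same_strings_sym: "same_strings C u v \<Longrightarrow> same_strings C v u"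
  by (simp add: same_strings_def)

lemma acts_left_same_strings:
  assumes "same_strings C u u'" "same_strings C v v'"
  shows "acts_left C k u v \<longleftrightarrow> acts_left C k u' v'"
  using assms by (cases k) (auto simp: same_strings_def)

lemma same_strings_append:
  assumes "same_strings C u u'" "same_strings C v v'"
  shows "same_strings C (u @ v) (u' @ v')"
  using assms by (auto simp: same_strings_def word_eps_append word_phi_append)

context ranked_crystal
begin

lemma map_option_append_Nil: "map_option ((@) []) x = x"
  by (cases x) auto

lemma act_free_append:
  "act (free_crystal C) k (u @ v) =
     (if acts_left C k u v then map_option (\<lambda>u'. u' @ v) (act (free_crystal C) k u)
      else map_option (\<lambda>v'. u @ v') (act (free_crystal C) k v))"
proof (cases k)
  case (E i)
  have "word_ee C i (u @ v) =
     (if word_eps C i v \<le> word_phi C i u then map_option (\<lambda>u'. u' @ v) (word_ee C i u)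
      else map_option (\<lambda>v'. u @ v') (word_ee C i v))"
    \<comment> \<open>For empty \<open>u\<close> the test holds only if
      \<open>word_eps C i v = 0\<close>, and then both sides are \<open>None\<close>.\<close>
    by (induction u) (auto simp: word_ee_None_iff word_eps_append map_option_append_Nil option.map_comp option.map_ident comp_def)
  then show ?thesis by (simp add: E free_ee)
next
  case (F i)
  have "word_ff C i (u @ v) =
     (if word_eps C i v < word_phi C i u then map_option (\<lambda>u'. u' @ v) (word_ff C i u)
      else map_option (\<lambda>v'. u @ v') (word_ff C i v))"
    by (induction u) (auto simp: word_ff_None_iff word_eps_append map_option_append_Nil option.map_comp option.map_ident comp_def)
  then show ?thesis by (simp add: F free_ff)
qed

lemma act_free_Nil [simp]: "act (free_crystal C) k [] = None"
  by (cases k) (auto simp: free_ee free_ff)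

lemma act_free_singleton: "act (free_crystal C) k [x] = map_option (\<lambda>x'. [x']) (act C k x)"
  by (cases k) (auto simp: free_ee free_ff ff_None_iff)

lemma act_free_length: "act (free_crystal C) k w = Some y \<Longrightarrow> length y = length w"
  by (cases k) (auto simp: free_ee free_ff dest: word_ee_Some word_ff_Some)

lemma act_free_None_same_strings:
  "same_strings C u v \<Longrightarrow> act (free_crystal C) k u = None \<longleftrightarrow> act (free_crystal C) k v = None"
  by (cases k) (auto simp: same_strings_def free_ee free_ff word_ee_None_iff word_ff_None_iff)

lemma act_free_closed:
  assumes closed: "\<And>k x y. x \<in> S \<Longrightarrow> act C k x = Some y \<Longrightarrow> y \<in> S"
  shows "w \<in> lists S \<Longrightarrow> act (free_crystal C) k w = Some y \<Longrightarrow> y \<in> lists S"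
proof (induction w arbitrary: y)
  case (Cons x w)
  have act: "act (free_crystal C) k ([x] @ w) = Some y" using Cons.prems by simp
  show ?case
  proof (cases "acts_left C k [x] w")
    case True
    then obtain x' where "act C k x = Some x'" "y = x' # w"
      using act[unfolded act_free_append] by (auto simp: act_free_singleton)
    then show ?thesis using closed[of x k x'] Cons.prems by simp
  next
    case False
    then obtain w' where "act (free_crystal C) k w = Some w'" "y = x # w'"
      using act[unfolded act_free_append] by auto
    then show ?thesis using Cons by simp
  qed
qed simp

end


section \<open>Bisimulations\<close>

text \<open>
  An isomorphism of components that sends \<open>x\<close> to \<open>y\<close> is the same as a bi-unique bisimulation
  relating \<open>x\<close> and \<open>y\<close>; in this form the tensor rule makes the congruence property of plactic
  equivalence immediate.
\<close>

definition bisimulation :: "'a crystal \<Rightarrow> ('a \<Rightarrow> 'a \<Rightarrow> bool) \<Rightarrow> bool" where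
  "bisimulation D R \<longleftrightarrow> bi_unique R \<and>
     (\<forall>a b. R a b \<longrightarrow> wt D a = wt D b \<and> (\<forall>k. rel_option R (act D k a) (act D k b)))"

definition bisimilar :: "'a crystal \<Rightarrow> 'a \<Rightarrow> 'a \<Rightarrow> bool" where
  "bisimilar D x y \<longleftrightarrow> (\<exists>R. bisimulation D R \<and> R x y)"

lemma bisimulation_act: "bisimulation D R \<Longrightarrow> R a b \<Longrightarrow> rel_option R (act D k a) (act D k b)"
  by (simp add: bisimulation_def)

lemma bisimulation_ee: "bisimulation D R \<Longrightarrow> R a b \<Longrightarrow> rel_option R (ee D i a) (ee D i b)"
  using bisimulation_act[of D R a b "E i"] by simp

lemma bisimulation_ff: "bisimulation D R \<Longrightarrow> R a b \<Longrightarrow> rel_option R (ff D i a) (ff D i b)"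
  using bisimulation_act[of D R a b "F i"] by simp

lemma rel_option_iter:
  assumes "\<And>a b. R a b \<Longrightarrow> rel_option R (g a) (h b)" and "R a b"
  shows "rel_option R (iter g n a) (iter h n b)"
  using assms(2)
proof (induction n arbitrary: a b)
  case (Suc n)
  then show ?case using assms(1)[OF Suc.prems] by (auto simp: iter_Suc split: option.splits)
qed simp

lemma rel_option_None_iff: "rel_option R x y \<Longrightarrow> x = None \<longleftrightarrow> y = None"
  by (cases x; cases y) auto

lemma bisimulation_eps: "bisimulation D R \<Longrightarrow> R a b \<Longrightarrow> eps D i a = eps D i b"
  unfolding eps_def
  using rel_option_None_iff[OF rel_option_iter[of R "ee D i" "ee D i", OF bisimulation_ee]]
  by presburger

lemma bisimulation_phi: "bisimulation D R \<Longrightarrow> R a b \<Longrightarrow> phi D i a = phi D i b"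
  unfolding phi_def
  using rel_option_None_iff[OF rel_option_iter[of R "ff D i" "ff D i", OF bisimulation_ff]]
  by presburger

lemma bisimilar_refl: "bisimilar D x x"
  unfolding bisimilar_def bisimulation_def
  by (intro exI[of _ "(=)"]) (auto simp: bi_unique_def option.rel_eq)

lemma bisimilar_sym:
  assumes "bisimilar D x y"
  shows "bisimilar D y x"
proof -
  obtain R where R: "bisimulation D R" "R x y" using assms by (auto simp: bisimilar_def)
  have "bi_unique R\<inverse>\<inverse>"
    using R(1) unfolding bisimulation_def bi_unique_def conversep_iff by blast
  then have "bisimulation D R\<inverse>\<inverse>"
    using R(1) by (simp add: bisimulation_def option.rel_conversep)
  then show ?thesis using R(2) by (auto simp: bisimilar_def)
qed

lemma bisimilar_trans:
  assumes "bisimilar D x y" "bisimilar D y z"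
  shows "bisimilar D x z"
proof -
  obtain R S where R: "bisimulation D R" "R x y" and S: "bisimulation D S" "S y z"
    using assms by (auto simp: bisimilar_def)
  have "bi_unique (R OO S)"
    using R(1) S(1) by (simp add: bisimulation_def bi_unique_OO)
  moreover have "wt D a = wt D c \<and> rel_option (R OO S) (act D k a) (act D k c)"
    if "R a b" "S b c" for a b c k
  proof
    show "wt D a = wt D c" using that R(1) S(1) by (simp add: bisimulation_def)
    show "rel_option (R OO S) (act D k a) (act D k c)"
      unfolding option.rel_compp
      by (rule relcomppI bisimulation_act R(1) S(1) that)+
  qed
  ultimately have "bisimulation D (R OO S)" unfolding bisimulation_def by blast
  then show ?thesis using R(2) S(2) unfolding bisimilar_def by blast
qed

lemma bisimilar_act:
  "bisimilar D x y \<Longrightarrow> act D k x = Some x' \<Longrightarrow> \<exists>y'. act D k y = Some y' \<and> bisimilar D x' y'"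
  unfolding bisimilar_def using bisimulation_act[of D _ x y k]
  by (metis option_rel_Some1)

lemma component_refl: "x \<in> elts (component D x)"
  by (simp add: component_def)

lemma component_act: "a \<in> elts (component D x) \<Longrightarrow> act D k a = Some b \<Longrightarrow> b \<in> elts (component D x)"
  by (auto simp: component_def intro: rtrancl_into_rtrancl)

lemma component_induct [consumes 1, case_names refl act]:
  assumes "a \<in> elts (component D x)" "P x"
    and "\<And>a b k. a \<in> elts (component D x) \<Longrightarrow> P a \<Longrightarrow> act D k a = Some b \<Longrightarrow> P b"
  shows "P a"
proof -
  have "(x, a) \<in> {(a, b). \<exists>k. act D k a = Some b}\<^sup>*"
    using assms(1) by (simp add: component_def)
  then show ?thesis
  proof (induction rule: rtrancl_induct)
    case (step y z)
    then show ?case using assms(3)[of y] by (auto simp: component_def)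
  qed (use assms(2) in simp)
qed

lemma component_simps [simp]:
  "ee (component D x) = ee D" "ff (component D x) = ff D" "wt (component D x) = wt D"
  "act (component D x) = act D" "eps (component D x) = eps D" "phi (component D x) = phi D"
proof -
  show *: "ee (component D x) = ee D" "ff (component D x) = ff D" "wt (component D x) = wt D"
    by (simp_all add: component_def)
  show "act (component D x) = act D"
  proof (intro ext)
    show "act (component D x) k a = act D k a" for k a by (cases k) (simp_all add: *)
  qed
  show "eps (component D x) = eps D" "phi (component D x) = phi D"
    by (simp_all add: eps_def[abs_def] phi_def[abs_def] *)
qed

lemma bisimilar_of_iso:
  assumes "crystal_iso (component D x) (component D y) \<psi>" "\<psi> x = y"
  shows "bisimilar D x y"
proof -
  let ?R = "\<lambda>a b. a \<in> elts (component D x) \<and> b = \<psi> a"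
  have "bi_unique ?R"
    using assms(1) by (auto simp: crystal_iso_def bij_betw_def bi_unique_def inj_on_def)
  moreover have "rel_option ?R (act D k a) (act D k (\<psi> a))" if "a \<in> elts (component D x)" for k a
  proof -
    have "act D k (\<psi> a) = map_option \<psi> (act D k a)"
      using assms(1) that by (cases k) (auto simp: crystal_iso_def)
    then show ?thesis using component_act[OF that] by (cases "act D k a") auto
  qed
  ultimately have "bisimulation D ?R"
    using assms(1) by (auto simp: bisimulation_def crystal_iso_def)
  then show ?thesis using assms(2) component_refl[of x D] unfolding bisimilar_def by blast
qed

text \<open>A bisimulation may also relate elements outside the two components. Following the same
  operators from \<open>x\<close> and from \<open>y\<close> shows that it matches the components
  completely, and bi-uniqueness turns this part of it into a bijection.\<close>

lemma iso_of_bisimilar: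
  assumes "bisimilar D x y"
  shows "\<exists>\<psi>. crystal_iso (component D x) (component D y) \<psi> \<and> \<psi> x = y"
proof -
  obtain R where R: "bisimulation D R" "R x y" using assms by (auto simp: bisimilar_def)
  have uniq: "R a b \<Longrightarrow> R a b' \<Longrightarrow> b = b'" "R a b \<Longrightarrow> R a' b \<Longrightarrow> a = a'" for a b a' b'
    using R(1) by (auto simp: bisimulation_def bi_unique_def)
  define \<psi> where "\<psi> = (\<lambda>a. THE b. R a b)"
  have \<psi>: "\<psi> a = b" if "R a b" for a b
    unfolding \<psi>_def using that uniq(1) by blast
  have right: "\<exists>b\<in>elts (component D y). R a b" if "a \<in> elts (component D x)" for a
    using that
  proof (induction rule: component_induct)
    case (act a a' k)
    from act.IH obtain b where b: "b \<in> elts (component D y)" "R a b" by (elim bexE)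
    obtain b' where "act D k b = Some b'" "R a' b'"
      using bisimulation_act[OF R(1) b(2), of k] unfolding \<open>act D k a = Some a'\<close>
      by (auto simp: option_rel_Some1)
    then show ?case using component_act[OF b(1)] by (intro bexI[of _ b'])
  qed (rule bexI, rule R(2), rule component_refl)
  have left: "\<exists>a\<in>elts (component D x). R a b" if "b \<in> elts (component D y)" for b
    using that
  proof (induction rule: component_induct)
    case (act b b' k)
    from act.IH obtain a where a: "a \<in> elts (component D x)" "R a b" by (elim bexE)
    obtain a' where "act D k a = Some a'" "R a' b'"
      using bisimulation_act[OF R(1) a(2), of k] unfolding \<open>act D k b = Some b'\<close>
      by (auto simp: option_rel_Some2)
    then show ?case using component_act[OF a(1)] by (intro bexI[of _ a'])
  qed (rule bexI, rule R(2), rule component_refl)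
  have R\<psi>: "R a (\<psi> a)" if "a \<in> elts (component D x)" for a
    using right[OF that] \<psi> by blast
  have "bij_betw \<psi> (elts (component D x)) (elts (component D y))"
  proof (rule bij_betwI')
    show "\<And>a a'. a \<in> elts (component D x) \<Longrightarrow> a' \<in> elts (component D x) \<Longrightarrow> \<psi> a = \<psi> a' \<longleftrightarrow> a = a'"
      using R\<psi> uniq(2) by metis
    show "\<And>a. a \<in> elts (component D x) \<Longrightarrow> \<psi> a \<in> elts (component D y)"
      using right \<psi> by metis
    show "\<And>b. b \<in> elts (component D y) \<Longrightarrow> \<exists>a\<in>elts (component D x). b = \<psi> a"
      using left \<psi> by metis
  qed
  moreover have "act D k (\<psi> a) = map_option \<psi> (act D k a)" if "a \<in> elts (component D x)" for a k
    using bisimulation_act[OF R(1) R\<psi>[OF that], of k] \<psi>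
    by (cases "act D k a"; cases "act D k (\<psi> a)") auto
  from this[of _ "E _"] this[of _ "F _"]
  have "ee D i (\<psi> a) = map_option \<psi> (ee D i a) \<and> ff D i (\<psi> a) = map_option \<psi> (ff D i a)"
    if "a \<in> elts (component D x)" for a i using that by simp
  moreover have "wt D (\<psi> a) = wt D a" if "a \<in> elts (component D x)" for a
    using R\<psi>[OF that] R(1) by (simp add: bisimulation_def)
  moreover have "eps D i (\<psi> a) = eps D i a" "phi D i (\<psi> a) = phi D i a"
    if "a \<in> elts (component D x)" for a i
    using bisimulation_eps[OF R(1) R\<psi>[OF that]] bisimulation_phi[OF R(1) R\<psi>[OF that]]
    by simp_all
  ultimately have "crystal_iso (component D x) (component D y) \<psi>"
    by (simp add: crystal_iso_def)
  then show ?thesis using \<psi>[OF R(2)] by (intro exI[of _ \<psi>] conjI)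
qed

lemma plactic_iff_bisimilar:
  "plactic T w w' \<longleftrightarrow> w \<in> elts (words T) \<and> w' \<in> elts (words T) \<and> bisimilar (words T) w w'"
proof -
  have "(\<exists>\<psi>. crystal_iso (component (words T) w) (component (words T) w') \<psi> \<and> \<psi> w = w')
      \<longleftrightarrow> bisimilar (words T) w w'"
  proof
    assume "bisimilar (words T) w w'"
    then show "\<exists>\<psi>. crystal_iso (component (words T) w) (component (words T) w') \<psi> \<and> \<psi> w = w'"
      by (rule iso_of_bisimilar)
  qed (elim exE conjE, rule bisimilar_of_iso)
  then show ?thesis by (simp add: plactic_def)
qed

context ranked_crystal
begin

lemma bisimilar_same_strings:
  assumes "bisimilar (free_crystal C) u v"
  shows "same_strings C u v"
proof -
  obtain R where R: "bisimulation (free_crystal C) R" "R u v"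
    using assms by (auto simp: bisimilar_def)
  show ?thesis
    using bisimulation_eps[OF R] bisimulation_phi[OF R]
    by (simp add: same_strings_def free_eps free_phi)
qed

lemma bisimilar_append:
  assumes "bisimilar (free_crystal C) u u'" "bisimilar (free_crystal C) v v'"
  shows "bisimilar (free_crystal C) (u @ v) (u' @ v')"
proof -
  obtain R S where R: "bisimulation (free_crystal C) R" "R u u'"
    and S: "bisimulation (free_crystal C) S" "S v v'"
    using assms by (auto simp: bisimilar_def)
  \<comment> \<open>Fixing the lengths of the left factors makes the splitting of a word unique,
    hence the relation bi-unique; the operators preserve these lengths.\<close>
  let ?Q = "\<lambda>a b. \<exists>a1 a2 b1 b2. a = a1 @ a2 \<and> b = b1 @ b2 \<and> R a1 b1 \<and> S a2 b2 \<and>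
    length a1 = length u \<and> length b1 = length u'"
  have "bi_unique ?Q"
    using R(1) S(1) unfolding bisimulation_def bi_unique_def
    by (elim conjE, intro conjI allI impI; elim exE conjE; simp; blast)
  moreover have "wt (free_crystal C) a = wt (free_crystal C) b \<and>
    rel_option ?Q (act (free_crystal C) k a) (act (free_crystal C) k b)" if Q: "?Q a b" for a b k
  proof -
    obtain a1 a2 b1 b2 where ab: "a = a1 @ a2" "b = b1 @ b2" "R a1 b1" "S a2 b2"
      "length a1 = length u" "length b1 = length u'" using Q by blast
    have left: "acts_left C k a1 a2 \<longleftrightarrow> acts_left C k b1 b2"
    proof (rule acts_left_same_strings)
      show "same_strings C a1 b1" "same_strings C a2 b2"
        by (rule bisimilar_same_strings, unfold bisimilar_def, intro exI conjI, rule R, rule ab,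
            rule bisimilar_same_strings, unfold bisimilar_def, intro exI conjI, rule S, rule ab)
    qed
    have r1: "rel_option R (act (free_crystal C) k a1) (act (free_crystal C) k b1)"
      and r2: "rel_option S (act (free_crystal C) k a2) (act (free_crystal C) k b2)"
      using bisimulation_act[OF R(1) ab(3)] bisimulation_act[OF S(1) ab(4)] by blast+
    have "rel_option ?Q (act (free_crystal C) k a) (act (free_crystal C) k b)"
    proof (cases "acts_left C k a1 a2")
      case True
      then have *: "act (free_crystal C) k a = map_option (\<lambda>x. x @ a2) (act (free_crystal C) k a1)"
        "act (free_crystal C) k b = map_option (\<lambda>x. x @ b2) (act (free_crystal C) k b1)"
        using left ab by (simp_all add: act_free_append)
      show ?thesis
        unfolding * option.rel_map
        by (rule option.rel_mono_strong[OF r1])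
          (use ab act_free_length[of k a1] act_free_length[of k b1] in auto)
    next
      case False
      then have *: "act (free_crystal C) k a = map_option (\<lambda>x. a1 @ x) (act (free_crystal C) k a2)"
        "act (free_crystal C) k b = map_option (\<lambda>x. b1 @ x) (act (free_crystal C) k b2)"
        using left ab by (simp_all add: act_free_append)
      show ?thesis
        unfolding * option.rel_map
        by (rule option.rel_mono_strong[OF r2]) (use ab in auto)
    qed
    moreover have "wt (free_crystal C) a = wt (free_crystal C) b"
      using ab R(1) S(1) by (simp add: wt_free_append bisimulation_def)
    ultimately show ?thesis by blast
  qed
  ultimately have "bisimulation (free_crystal C) ?Q" by (simp add: bisimulation_def)
  moreover have "?Q (u @ v) (u' @ v')" using R(2) S(2) by blast
  ultimately show ?thesis unfolding bisimilar_def by (intro exI[of _ ?Q]) simp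
qed

end

section \<open>Composites and 2-cells\<close>

lemma composite_tgt_Nil [simp]: "composite_tgt (u, []) = u"
  by (simp add: composite_tgt_def)

lemma composite_tgt_Cons [simp]: "composite_tgt (u, s # ss) = composite_tgt (step_tgt s, ss)"
  by (simp add: composite_tgt_def)

lemma composite_tgt_append: "composite_tgt (u, xs @ ys) = composite_tgt (composite_tgt (u, xs), ys)"
  by (induction xs arbitrary: u) auto

lemma path_from_append:
  "path_from X u xs \<Longrightarrow> path_from X u (xs @ ys) \<longleftrightarrow> path_from X (composite_tgt (u, xs)) ys"
  by (induction xs arbitrary: u) auto

lemma path_from_appendD: "path_from X u (xs @ ys) \<Longrightarrow> path_from X (composite_tgt (u, xs)) ys"
  by (induction xs arbitrary: u) auto

lemma path_from_replace:
  assumes "path_from X u (xs @ ys @ zs)"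
    and "path_from X (composite_tgt (u, xs)) ys'"
    and "composite_tgt (composite_tgt (u, xs), ys') = composite_tgt (composite_tgt (u, xs), ys)"
  shows "path_from X u (xs @ ys' @ zs)"
  using assms
proof (induction xs arbitrary: u)
  case Nil
  then show ?case by (auto simp: path_from_append dest: path_from_appendD)
qed auto

lemma rule_inv_src [simp]: "rule_src (rule_inv \<alpha>) = rule_tgt \<alpha>"
  by (cases \<alpha>) auto

lemma rule_inv_tgt [simp]: "rule_tgt (rule_inv \<alpha>) = rule_src \<alpha>"
  by (cases \<alpha>) auto

locale polygraph =
  fixes X :: "'a polygraph"
  assumes rules_words: "(s, t) \<in> rules X \<Longrightarrow> s \<in> lists (gens X) \<and> t \<in> lists (gens X)"
begin

lemma srule_words:
  "\<alpha> \<in> signed_rules X \<Longrightarrow> rule_src \<alpha> \<in> lists (gens X) \<and> rule_tgt \<alpha> \<in> lists (gens X)"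
  by (cases \<alpha>) (auto simp: signed_rules_def dest: rules_words)

lemma step_tgt_words: "s \<in> steps X \<Longrightarrow> step_tgt s \<in> lists (gens X)"
  by (cases s) (auto simp: steps_def dest: srule_words)

lemma path_from_words: "path_from X u ss \<Longrightarrow> u \<in> lists (gens X)"
  by (cases ss) (auto simp: steps_def dest!: srule_words)

text \<open>This makes the choice of a representative in \<open>cell_src\<close> and
  \<open>cell_tgt\<close> harmless.\<close>

lemma congr_composites:
  "congr X p q \<Longrightarrow> p \<in> composites X \<and> q \<in> composites X \<and> fst p = fst q \<and>
     composite_tgt p = composite_tgt q"
proof (induction rule: congr.induct)
  case (exchange s xs t \<alpha> w \<beta> v ys)
  let ?old = "[(t, \<alpha>, w @ rule_src \<beta> @ v), (t @ rule_tgt \<alpha> @ w, \<beta>, v)]"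
  let ?new = "[(t @ rule_src \<alpha> @ w, \<beta>, v), (t, \<alpha>, w @ rule_tgt \<beta> @ v)]"
  have path: "path_from X s (xs @ ?old @ ys)" using exchange by (simp add: composites_def)
  have old: "path_from X (composite_tgt (s, xs)) (?old @ ys)" by (rule path_from_appendD[OF path])
  then have mem: "t \<in> lists (gens X)" "w \<in> lists (gens X)" "v \<in> lists (gens X)"
    "\<alpha> \<in> signed_rules X" "\<beta> \<in> signed_rules X" by (auto simp: steps_def)
  have "path_from X s (xs @ ?new @ ys)"
    by (rule path_from_replace[OF path])
      (use old mem srule_words[OF mem(4)] srule_words[OF mem(5)] in \<open>auto simp: steps_def\<close>)
  then show ?case using path by (simp add: composites_def composite_tgt_append)
next
  case (inverse s xs t \<alpha> v ys)
  let ?old = "[(t, \<alpha>, v), (t, rule_inv \<alpha>, v)]"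
  have path: "path_from X s (xs @ ?old @ ys)" using inverse by (simp add: composites_def)
  have old: "path_from X (composite_tgt (s, xs)) (?old @ ys)" by (rule path_from_appendD[OF path])
  have "path_from X s (xs @ [] @ ys)"
    by (rule path_from_replace[OF path]) (use old path_from_words[OF old] in auto)
  then show ?case using path old by (simp add: composites_def composite_tgt_append)
qed auto

lemma equiv_congr_rel: "equiv (composites X) (congr_rel X)"
proof (rule equivI)
  show "congr_rel X \<subseteq> composites X \<times> composites X"
    using congr_composites by (auto simp: congr_rel_def)
  show "refl_on (composites X) (congr_rel X)"
    by (rule refl_onI) (simp add: congr_rel_def congr.refl)
  show "sym (congr_rel X)"
    by (rule symI) (simp add: congr_rel_def congr.sym)
  show "trans (congr_rel X)"
    by (rule transI, simp add: congr_rel_def, erule (1) congr.trans)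
qed

section \<open>2-cells as congruence classes, and their vertical composition\<close>

lemma cell_eq_class:
  assumes "\<gamma> \<in> cells X" "p \<in> \<gamma>"
  shows "\<gamma> = congr_rel X `` {p}"
proof -
  obtain q where "\<gamma> = congr_rel X `` {q}"
    using assms(1) unfolding cells_def by (rule quotientE)
  then show ?thesis
    using assms(2) equiv_class_eq[OF equiv_congr_rel, of q p] by simp
qed

lemma cell_composite: "\<gamma> \<in> cells X \<Longrightarrow> p \<in> \<gamma> \<Longrightarrow> p \<in> composites X"
  using in_quotient_imp_subset[OF equiv_congr_rel] unfolding cells_def by (rule subsetD)

lemma cell_nonempty:
  assumes "\<gamma> \<in> cells X"
  obtains p where "p \<in> \<gamma>"
  using in_quotient_imp_non_empty[OF equiv_congr_rel assms[unfolded cells_def]] by auto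

lemma class_in_cells: "p \<in> composites X \<Longrightarrow> congr_rel X `` {p} \<in> cells X"
  by (simp add: cells_def quotientI)

lemma class_self: "p \<in> composites X \<Longrightarrow> p \<in> congr_rel X `` {p}"
  by (simp add: congr_rel_def congr.refl)

lemma cell_congr: "\<gamma> \<in> cells X \<Longrightarrow> p \<in> \<gamma> \<Longrightarrow> q \<in> \<gamma> \<Longrightarrow> congr X p q"
  using cell_eq_class[of \<gamma> p] by (auto simp: congr_rel_def)

lemma cell_src_eq: "\<gamma> \<in> cells X \<Longrightarrow> p \<in> \<gamma> \<Longrightarrow> cell_src \<gamma> = fst p"
  unfolding cell_src_def
  by (rule someI2[of _ p]) (use congr_composites cell_congr in blast)+

lemma cell_tgt_eq: "\<gamma> \<in> cells X \<Longrightarrow> p \<in> \<gamma> \<Longrightarrow> cell_tgt \<gamma> = composite_tgt p"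
  unfolding cell_tgt_def
  by (rule someI2[of _ p]) (use congr_composites cell_congr in blast)+

text \<open>Both \<open>vcomp\<close> and \<open>act_cell\<close> saturate a set of composites under
  the congruence. Once these composites are known to be congruent, one of them suffices to compute
  the result.\<close>

lemma class_of_set:
  assumes "p \<in> A" "\<And>q. q \<in> A \<Longrightarrow> congr X p q"
  shows "congr_rel X `` A = congr_rel X `` {p}"
proof (intro equalityI subsetI)
  fix r assume "r \<in> congr_rel X `` A"
  then obtain q where "q \<in> A" "congr X q r" by (auto simp: congr_rel_def)
  then show "r \<in> congr_rel X `` {p}"
    using congr.trans[OF assms(2)] by (simp add: congr_rel_def)
qed (use assms(1) in auto)

text \<open>The generating relations already carry a context of steps on both sides, which absorbs
  \<open>xs\<close> and \<open>ys\<close>.\<close>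

lemma congr_extend:
  "congr X p q \<Longrightarrow> path_from X a xs \<Longrightarrow> composite_tgt (a, xs) = fst p \<Longrightarrow>
     path_from X (composite_tgt p) ys \<Longrightarrow> congr X (a, xs @ snd p @ ys) (a, xs @ snd q @ ys)"
proof (induction rule: congr.induct)
  case (refl p)
  then show ?case
    by (intro congr.refl) (cases p, auto simp: composites_def path_from_append)
next
  case (sym p q)
  then show ?case using congr_composites[OF sym.hyps] by (simp add: congr.sym)
next
  case (trans p q r)
  then have "congr X (a, xs @ snd p @ ys) (a, xs @ snd q @ ys)"
    "congr X (a, xs @ snd q @ ys) (a, xs @ snd r @ ys)"
    using congr_composites[OF trans.hyps(1)] by simp_all
  then show ?case by (rule congr.trans)
next
  case (exchange s us t \<alpha> w \<beta> v vs)
  have "(a, (xs @ us) @ [(t, \<alpha>, w @ rule_src \<beta> @ v), (t @ rule_tgt \<alpha> @ w, \<beta>, v)] @ (vs @ ys))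
      \<in> composites X"
    using exchange path_from_append[of X s _ ys] unfolding composites_def
    by (fastforce simp: path_from_append)
  from congr.exchange[OF this] show ?case by simp
next
  case (inverse s us t \<alpha> v vs)
  have "(a, (xs @ us) @ [(t, \<alpha>, v), (t, rule_inv \<alpha>, v)] @ (vs @ ys)) \<in> composites X"
    using inverse path_from_append[of X s _ ys] unfolding composites_def
    by (fastforce simp: path_from_append)
  from congr.inverse[OF this] show ?case by simp
qed

lemma congr_vcomp:
  assumes "congr X p p'" "congr X q q'" "composite_tgt p = fst q"
  shows "congr X (fst p, snd p @ snd q) (fst p', snd p' @ snd q')"
proof -
  have p: "path_from X (fst p) (snd p)" "path_from X (fst p') (snd p')" "fst p = fst p'"
    "composite_tgt p = composite_tgt p'"
    and q: "path_from X (fst q) (snd q)" "path_from X (fst q') (snd q')" "fst q = fst q'"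
    using congr_composites[OF assms(1)] congr_composites[OF assms(2)] by (auto simp: composites_def)
  have nil: "path_from X (fst p) []" "path_from X (composite_tgt q) []"
    using path_from_words[OF p(1)] path_from_appendD[of X "fst q" "snd q" "[]"] q(1) by simp_all
  have "congr X (fst p, [] @ snd p @ snd q) (fst p, [] @ snd p' @ snd q)"
    by (rule congr_extend[OF assms(1)]) (use nil assms(3) q in auto)
  moreover have "congr X (fst p, snd p' @ snd q @ []) (fst p, snd p' @ snd q' @ [])"
    by (rule congr_extend[OF assms(2)]) (use nil assms(3) p q in auto)
  ultimately show ?thesis using congr.trans p(3) by fastforce
qed

lemma vcomp_eq_class:
  assumes "\<gamma> \<in> cells X" "\<delta> \<in> cells X" "p \<in> \<gamma>" "q \<in> \<delta>" "composite_tgt p = fst q"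
  shows "vcomp X \<gamma> \<delta> = congr_rel X `` {(fst p, snd p @ snd q)}"
  unfolding vcomp_def
proof (rule class_of_set)
  show "(fst p, snd p @ snd q) \<in> {(u, ss @ ts) |u ss v ts. (u, ss) \<in> \<gamma> \<and> (v, ts) \<in> \<delta>}"
    using assms(3,4) by (cases p; cases q) auto
next
  fix r assume "r \<in> {(u, ss @ ts) |u ss v ts. (u, ss) \<in> \<gamma> \<and> (v, ts) \<in> \<delta>}"
  then obtain p' q' where "p' \<in> \<gamma>" "q' \<in> \<delta>" and r: "r = (fst p', snd p' @ snd q')" by force
  then have "congr X p p'" "congr X q q'" using cell_congr assms by blast+
  then show "congr X (fst p, snd p @ snd q) r"
    unfolding r using assms(5) by (rule congr_vcomp)
qed

lemma vcomp_cell: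
  assumes "\<gamma> \<in> cells X" "\<delta> \<in> cells X" "cell_tgt \<gamma> = cell_src \<delta>"
  shows "vcomp X \<gamma> \<delta> \<in> cells X \<and> cell_src (vcomp X \<gamma> \<delta>) = cell_src \<gamma> \<and>
    cell_tgt (vcomp X \<gamma> \<delta>) = cell_tgt \<delta>"
proof -
  obtain p q where pq: "p \<in> \<gamma>" "q \<in> \<delta>"
    using cell_nonempty[OF assms(1)] cell_nonempty[OF assms(2)] by metis
  have tgt: "composite_tgt p = fst q"
    using assms pq by (simp add: cell_src_eq[OF _ pq(2)] cell_tgt_eq[OF _ pq(1)])
  let ?r = "(fst p, snd p @ snd q)"
  have v: "vcomp X \<gamma> \<delta> = congr_rel X `` {?r}" by (rule vcomp_eq_class[OF assms(1,2) pq tgt])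
  have r: "?r \<in> composites X"
    using congr_vcomp[OF cell_congr[OF assms(1) pq(1,1)] cell_congr[OF assms(2) pq(2,2)] tgt]
      congr_composites by blast
  have c: "vcomp X \<gamma> \<delta> \<in> cells X" and m: "?r \<in> vcomp X \<gamma> \<delta>"
    unfolding v using class_in_cells[OF r] class_self[OF r] .
  have "composite_tgt ?r = composite_tgt q"
    using tgt by (simp add: composite_tgt_append)
  then show ?thesis
    using c cell_src_eq[OF c m] cell_tgt_eq[OF c m] cell_src_eq[OF assms(1) pq(1)]
      cell_tgt_eq[OF assms(2) pq(2)] by simp
qed

lemma step_cell:
  assumes "s \<in> steps X"
  shows "step_cell X s \<in> cells X \<and> (step_src s, [s]) \<in> step_cell X s \<and>
    cell_src (step_cell X s) = step_src s \<and> cell_tgt (step_cell X s) = step_tgt s"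
proof -
  have c: "(step_src s, [s]) \<in> composites X"
    using assms step_tgt_words[OF assms] by (simp add: composites_def)
  then have *: "step_cell X s \<in> cells X" "(step_src s, [s]) \<in> step_cell X s"
    unfolding step_cell_def using class_in_cells class_self by blast+
  then show ?thesis using cell_src_eq[OF *] cell_tgt_eq[OF *] by simp
qed

end

section \<open>Equivariance of the (2,1)-monoid\<close>

text \<open>What the column presentation has to satisfy for its 2-cells to inherit the operators.
  Equal strings of the two sides keep the place of action, \<open>rules_act\<close> provides the
  image of a rule, and functionality identifies it with the one chosen by \<open>THE\<close> in
  \<open>act_rule\<close>.\<close>

locale crystal_polygraph = ranked_crystal C + polygraph X
  for C :: "'a crystal" and X :: "'a polygraph" +
  assumes gens_act: "x \<in> gens X \<Longrightarrow> act C k x = Some y \<Longrightarrow> y \<in> gens X"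
    and rules_functional: "(s, t) \<in> rules X \<Longrightarrow> (s, t') \<in> rules X \<Longrightarrow> t = t'"
    and rules_same_strings: "(s, t) \<in> rules X \<Longrightarrow> same_strings C s t"
    and rules_act: "(s, t) \<in> rules X \<Longrightarrow> act (free_crystal C) k s = Some s' \<Longrightarrow>
      \<exists>t'. act (free_crystal C) k t = Some t' \<and> (s', t') \<in> rules X"
begin

abbreviation act_word :: "kashiwara \<Rightarrow> 'a list \<Rightarrow> 'a list option" where
  "act_word \<equiv> act (free_crystal C)"

lemma act_word_words: "w \<in> lists (gens X) \<Longrightarrow> act_word k w = Some y \<Longrightarrow> y \<in> lists (gens X)"
  by (rule act_free_closed) (use gens_act in auto)

lemma srule_same_strings: "\<alpha> \<in> signed_rules X \<Longrightarrow> same_strings C (rule_src \<alpha>) (rule_tgt \<alpha>)"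
  by (cases \<alpha>) (auto simp: signed_rules_def intro: rules_same_strings same_strings_sym[OF rules_same_strings])

lemma act_rule_Some:
  assumes "(s, t) \<in> rules X" "act_word k s = Some s'"
  obtains t' where "act_rule C X k (s, t) = Some (s', t')" "(s', t') \<in> rules X"
    "act_word k t = Some t'"
proof -
  obtain t' where t': "act_word k t = Some t'" "(s', t') \<in> rules X"
    using rules_act[OF assms] by blast
  then have "(THE t. (s', t) \<in> rules X) = t'"
    using rules_functional by blast
  then show thesis
    using t' assms(2) that by (simp add: act_rule_def)
qed

text \<open>For a reversed rule the operator is known to be defined on the target of the rule, while
  \<open>act_rule\<close> works on its source; equal strings transfer definedness. The last two
  conclusions serve the inverse law and the recognition of images of rewriting steps.\<close>

lemma act_srule_Some:
  assumes "\<alpha> \<in> signed_rules X" "act_word k (rule_src \<alpha>) = Some s'"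
  obtains \<alpha>' where "act_srule C X k \<alpha> = Some \<alpha>'" "\<alpha>' \<in> signed_rules X" "rule_src \<alpha>' = s'"
    "act_word k (rule_tgt \<alpha>) = Some (rule_tgt \<alpha>')"
    "act_srule C X k (rule_inv \<alpha>) = Some (rule_inv \<alpha>')" "(\<exists>r. \<alpha> = Fwd r) \<longleftrightarrow> (\<exists>r. \<alpha>' = Fwd r)"
proof -
  obtain r where r: "r \<in> rules X" "\<alpha> = Fwd r \<or> \<alpha> = Rev r"
    using assms(1) by (auto simp: signed_rules_def)
  obtain s t where st: "r = (s, t)" by (cases r)
  have "act_word k s \<noteq> None"
    using assms(2) r st act_free_None_same_strings[OF rules_same_strings[of s t], of k]
    by (auto simp del: not_None_eq)
  then obtain s1 where s1: "act_word k s = Some s1" by auto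
  obtain t1 where t1: "act_rule C X k r = Some (s1, t1)" "(s1, t1) \<in> rules X" "act_word k t = Some t1"
    using act_rule_Some[of s t k s1] r s1 st by metis
  show thesis
    using r(2)
  proof
    assume "\<alpha> = Fwd r"
    then show thesis
      using that[of "Fwd (s1, t1)"] t1 assms(2) s1 st by (simp add: signed_rules_def)
  next
    assume "\<alpha> = Rev r"
    then show thesis
      using that[of "Rev (s1, t1)"] t1 assms(2) s1 st by (simp add: signed_rules_def)
  qed
qed

text \<open>This replaces the comparison of words in \<open>act_step\<close> by the tests of the
  tensor rule. The branches are tried from left to right, so it must be excluded that an action
  further right looks like an action on an earlier factor.\<close>

lemma act_step_eq:
  assumes "act_word k (t @ rule_src \<alpha> @ v) \<noteq> None"
  shows "act_step C X k (t, \<alpha>, v) =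
    (if acts_left C k t (rule_src \<alpha> @ v) then map_option (\<lambda>t'. (t', \<alpha>, v)) (act_word k t)
     else if acts_left C k (rule_src \<alpha>) v
       then map_option (\<lambda>\<alpha>'. (t, \<alpha>', v)) (act_srule C X k \<alpha>)
     else map_option (\<lambda>v'. (t, \<alpha>, v')) (act_word k v))"
proof -
  interpret free: ranked_crystal "free_crystal C" by (rule ranked_free_crystal)
  let ?s = "rule_src \<alpha>"
  \<comment> \<open>If the operator turns \<open>u @ w\<close> into \<open>u @ w'\<close> and this
    also has the form \<open>u' @ w\<close>, then equal lengths force \<open>w' = w\<close>, which
    \<open>act_neq\<close> forbids.\<close>
  have neq: "act_word k (u @ w) \<noteq> map_option (\<lambda>u'. u' @ w) (act_word k u)"
    if right: "\<not> acts_left C k u w" "act_word k (u @ w) \<noteq> None" for u w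
  proof
    assume eq: "act_word k (u @ w) = map_option (\<lambda>u'. u' @ w) (act_word k u)"
    obtain w' where w': "act_word k w = Some w'" "act_word k (u @ w) = Some (u @ w')"
      using right by (auto simp: act_free_append)
    then have "u @ w' = u' @ w" if "act_word k u = Some u'" for u' using eq that by simp
    moreover obtain u' where u': "act_word k u = Some u'"
      using eq w' by (cases "act_word k u") simp_all
    ultimately have "w' = w"
      using act_free_length[OF u'] by (metis append_eq_append_conv)
    then show False using w'(1) free.act_neq by metis
  qed
  show ?thesis
  proof (cases "acts_left C k t (?s @ v)")
    case True
    then show ?thesis using assms by (simp add: Let_def act_free_append)
  next
    case False
    have 1: "act_word k (t @ ?s @ v) \<noteq> map_option (\<lambda>t'. t' @ ?s @ v) (act_word k t)"
      by (rule neq[OF False assms])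
    have 2: "act_word k (t @ ?s @ v) = map_option (\<lambda>x. t @ x) (act_word k (?s @ v))"
      using False by (simp add: act_free_append)
    have sv: "act_word k (?s @ v) \<noteq> None" using 2 assms by auto
    have 3: "act_word k (t @ ?s @ v) = map_option (\<lambda>s'. t @ s' @ v) (act_word k ?s) \<longleftrightarrow>
        act_word k (?s @ v) = map_option (\<lambda>s'. s' @ v) (act_word k ?s)"
      unfolding 2 by (cases "act_word k (?s @ v)"; cases "act_word k ?s") auto
    have 4: "act_word k (?s @ v) = map_option (\<lambda>s'. s' @ v) (act_word k ?s) \<longleftrightarrow>
        acts_left C k ?s v"
      using neq[OF _ sv] by (cases "acts_left C k ?s v") (simp_all add: act_free_append)
    show ?thesis using assms False 1 3 4 by (simp only: act_step.simps Let_def if_True if_False)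
  qed
qed

declare act_step.simps [simp del]

text \<open>The lengths of the whiskers and the orientation of the rule are recorded so that
  \<open>critical_act\<close> can recognise the image as a rewriting step of the same shape.\<close>

lemma act_step_Some:
  assumes "(t, \<alpha>, v) \<in> steps X" "act_word k (step_src (t, \<alpha>, v)) = Some u"
  obtains t' \<alpha>' v' where "act_step C X k (t, \<alpha>, v) = Some (t', \<alpha>', v')" "(t', \<alpha>', v') \<in> steps X"
    "step_src (t', \<alpha>', v') = u"
    "act_word k (step_tgt (t, \<alpha>, v)) = Some (step_tgt (t', \<alpha>', v'))"
    "length t' = length t" "length v' = length v" "(\<exists>r. \<alpha> = Fwd r) \<longleftrightarrow> (\<exists>r. \<alpha>' = Fwd r)"
proof -
  let ?s = "rule_src \<alpha>"
  have mem: "t \<in> lists (gens X)" "\<alpha> \<in> signed_rules X" "v \<in> lists (gens X)"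
    using assms(1) by (auto simp: steps_def)
  have u: "act_word k (t @ ?s @ v) = Some u" using assms(2) by simp
  note eq = act_step_eq[of k t \<alpha> v]
  have refl: "same_strings C x x" for x by (simp add: same_strings_def)
  have left1: "acts_left C k t (rule_tgt \<alpha> @ v) \<longleftrightarrow> acts_left C k t (?s @ v)"
    by (intro acts_left_same_strings same_strings_append refl same_strings_sym[OF srule_same_strings[OF mem(2)]])
  have left2: "acts_left C k (rule_tgt \<alpha>) v \<longleftrightarrow> acts_left C k ?s v"
    by (intro acts_left_same_strings refl same_strings_sym[OF srule_same_strings[OF mem(2)]])
  consider (left) "acts_left C k t (?s @ v)"
    | (mid) "\<not> acts_left C k t (?s @ v)" "acts_left C k ?s v"
    | (right) "\<not> acts_left C k t (?s @ v)" "\<not> acts_left C k ?s v" by blast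
  then show thesis
  proof cases
    case left
    then obtain t' where t': "act_word k t = Some t'" "u = t' @ ?s @ v"
      using u by (auto simp: act_free_append)
    show thesis
      by (rule that[of t' \<alpha> v])
        (use left left1 t' u eq mem act_word_words[OF mem(1) t'(1)] act_free_length[OF t'(1)] in
          \<open>auto simp: steps_def act_free_append\<close>)
  next
    case mid
    then obtain s' where s': "act_word k ?s = Some s'" "u = t @ s' @ v"
      using u by (auto simp: act_free_append)
    obtain \<alpha>' where \<alpha>': "act_srule C X k \<alpha> = Some \<alpha>'" "\<alpha>' \<in> signed_rules X" "rule_src \<alpha>' = s'"
      "act_word k (rule_tgt \<alpha>) = Some (rule_tgt \<alpha>')" "(\<exists>r. \<alpha> = Fwd r) \<longleftrightarrow> (\<exists>r. \<alpha>' = Fwd r)"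
      by (rule act_srule_Some[OF mem(2) s'(1)])
    show thesis
      by (rule that[of t \<alpha>' v])
        (use mid left1 left2 s' u eq mem \<alpha>' in \<open>simp_all add: steps_def act_free_append\<close>)
  next
    case right
    then obtain v' where v': "act_word k v = Some v'" "u = t @ ?s @ v'"
      using u by (auto simp: act_free_append)
    show thesis
      by (rule that[of t \<alpha> v'])
        (use right left1 left2 v' u eq mem act_word_words[OF mem(3) v'(1)] act_free_length[OF v'(1)] in
          \<open>auto simp: steps_def act_free_append\<close>)
  qed
qed

definition step_image :: "kashiwara \<Rightarrow> 'a step \<Rightarrow> 'a step" where
  "step_image k = the \<circ> act_step C X k"

lemma step_image:
  assumes "s \<in> steps X" "act_word k (step_src s) = Some u"
  shows "step_image k s \<in> steps X \<and> step_src (step_image k s) = u \<and>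
    act_word k (step_tgt s) = Some (step_tgt (step_image k s))"
proof -
  obtain t \<alpha> v where s: "s = (t, \<alpha>, v)" by (cases s)
  show ?thesis
    unfolding s by (rule act_step_Some[OF assms[unfolded s]]) (simp add: step_image_def)
qed

lemma path_image:
  "path_from X u ss \<Longrightarrow> act_word k u = Some u' \<Longrightarrow>
     path_from X u' (map (step_image k) ss) \<and>
     act_word k (composite_tgt (u, ss)) = Some (composite_tgt (u', map (step_image k) ss))"
proof (induction ss arbitrary: u u')
  case Nil
  then show ?case using act_word_words by auto
next
  case (Cons s ss)
  then have "s \<in> steps X" "act_word k (step_src s) = Some u'" by auto
  from step_image[OF this] show ?case
    using Cons.IH[of "step_tgt s" "step_tgt (step_image k s)"] Cons.prems(1) by simp
qed

text \<open>The four sides of the exchange square split the word differently and contain either side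
  of each rule. In each of the five cases exactly one of \<open>t\<close>, \<alpha>,
  \<open>w\<close>, \<beta>, \<open>v\<close> moves, and it is the same one on all four sides, so
  the image is again an exchange square.\<close>

lemma exchange_image:
  assumes mem: "t \<in> lists (gens X)" "\<alpha> \<in> signed_rules X" "w \<in> lists (gens X)"
      "\<beta> \<in> signed_rules X" "v \<in> lists (gens X)"
    and act: "act_word k (t @ rule_src \<alpha> @ w @ rule_src \<beta> @ v) = Some m"
  obtains t' \<alpha>' w' \<beta>' v' where
    "step_image k (t, \<alpha>, w @ rule_src \<beta> @ v) = (t', \<alpha>', w' @ rule_src \<beta>' @ v')"
    "step_image k (t @ rule_tgt \<alpha> @ w, \<beta>, v) = (t' @ rule_tgt \<alpha>' @ w', \<beta>', v')"
    "step_image k (t @ rule_src \<alpha> @ w, \<beta>, v) = (t' @ rule_src \<alpha>' @ w', \<beta>', v')"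
    "step_image k (t, \<alpha>, w @ rule_tgt \<beta> @ v) = (t', \<alpha>', w' @ rule_tgt \<beta>' @ v')"
proof -
  let ?a = "rule_src \<alpha>" and ?a' = "rule_tgt \<alpha>" and ?b = "rule_src \<beta>" and ?b' = "rule_tgt \<beta>"
  note a = srule_same_strings[OF mem(2)] and b = srule_same_strings[OF mem(4)]
  have refl: "same_strings C x x" for x by (simp add: same_strings_def)
  note ss = refl a b same_strings_append
  have A: "acts_left C k t (?a' @ w @ ?b @ v) \<longleftrightarrow> acts_left C k t (?a @ w @ ?b @ v)"
    "acts_left C k ?a' (w @ ?b @ v) \<longleftrightarrow> acts_left C k ?a (w @ ?b @ v)"
    "acts_left C k t (?a @ w @ ?b' @ v) \<longleftrightarrow> acts_left C k t (?a @ w @ ?b @ v)"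
    "acts_left C k ?a (w @ ?b' @ v) \<longleftrightarrow> acts_left C k ?a (w @ ?b @ v)"
    by (rule acts_left_same_strings[symmetric]; intro ss)+
  have n1: "act_word k (t @ ?a @ w @ ?b @ v) \<noteq> None" using act by simp
  \<comment> \<open>The sources of the second steps have the same strings as the common source, so
    the operator does not kill them either.\<close>
  have n2: "act_word k ((t @ ?a' @ w) @ ?b @ v) \<noteq> None"
    "act_word k (t @ ?a @ (w @ ?b' @ v)) \<noteq> None"
    using n1 act_free_None_same_strings[of "t @ ?a @ w @ ?b @ v" "t @ ?a' @ w @ ?b @ v" k]
      act_free_None_same_strings[of "t @ ?a @ w @ ?b @ v" "t @ ?a @ w @ ?b' @ v" k]
    by (simp_all add: ss)
  have n3: "act_word k ((t @ ?a @ w) @ ?b @ v) \<noteq> None" using n1 by simp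
  have e1: "act_step C X k (t, \<alpha>, w @ ?b @ v) = (if acts_left C k t (?a @ w @ ?b @ v)
      then map_option (\<lambda>t'. (t', \<alpha>, w @ ?b @ v)) (act_word k t)
     else if acts_left C k ?a (w @ ?b @ v)
       then map_option (\<lambda>\<alpha>'. (t, \<alpha>', w @ ?b @ v)) (act_srule C X k \<alpha>)
     else map_option (\<lambda>v'. (t, \<alpha>, v')) (act_word k (w @ ?b @ v)))"
    using act_step_eq[of k t \<alpha> "w @ ?b @ v"] n1 by simp
  have e4: "act_step C X k (t, \<alpha>, w @ ?b' @ v) = (if acts_left C k t (?a @ w @ ?b @ v)
      then map_option (\<lambda>t'. (t', \<alpha>, w @ ?b' @ v)) (act_word k t)
     else if acts_left C k ?a (w @ ?b @ v)
       then map_option (\<lambda>\<alpha>'. (t, \<alpha>', w @ ?b' @ v)) (act_srule C X k \<alpha>)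
     else map_option (\<lambda>v'. (t, \<alpha>, v')) (act_word k (w @ ?b' @ v)))"
    using act_step_eq[of k t \<alpha> "w @ ?b' @ v"] n2(2) A by simp
  \<comment> \<open>The left whisker of \<beta> is a product of three factors, whose joint test
    splits into the tests of the case distinction below. Both sides of \<alpha> are treated at
    once.\<close>
  have e2: "act_step C X k (t @ x @ w, \<beta>, v) =
      (if acts_left C k t (?a @ w @ ?b @ v) \<or> acts_left C k ?a (w @ ?b @ v) \<or> acts_left C k w (?b @ v)
       then map_option (\<lambda>t'. (t', \<beta>, v)) (act_word k (t @ x @ w))
     else if acts_left C k ?b v
       then map_option (\<lambda>\<beta>'. (t @ x @ w, \<beta>', v)) (act_srule C X k \<beta>)
     else map_option (\<lambda>v'. (t @ x @ w, \<beta>, v')) (act_word k v))" if "x = ?a \<or> x = ?a'" for x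
    using that act_step_eq[of k "t @ x @ w" \<beta> v] n2(1) n3 A by (auto simp: acts_left_append_left)
  have B: "acts_left C k ?a' w \<longleftrightarrow> acts_left C k ?a w" "acts_left C k t (?a' @ w) \<longleftrightarrow> acts_left C k t (?a @ w)"
    "acts_left C k w (?b' @ v) \<longleftrightarrow> acts_left C k w (?b @ v)" "acts_left C k ?b' v \<longleftrightarrow> acts_left C k ?b v"
    by (rule acts_left_same_strings[symmetric]; intro ss)+
  \<comment> \<open>Here and in \<open>absorb\<close> a right context is removed from a test: the
    step with \<beta> applies the operator to \<open>t @ x @ w\<close> alone, whereas the cases
    refer to the whole word. A shorter context has a smaller \<open>word_eps\<close>; and if the
    operator prefers \<open>y\<close> to \<open>z\<close>, then \<open>y @ z\<close> has the
    \<open>word_eps\<close> of \<open>y\<close>.\<close>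
  have anti: "acts_left C k x y" if "acts_left C k x (y @ z)" for x y z
    using that by (cases k) (auto simp: word_eps_append)
  have absorb: "acts_left C k x (y @ z) \<longleftrightarrow> acts_left C k x y" if "acts_left C k y z" for x y z
    using that by (cases k) (auto simp: word_eps_append)
  consider (t) "acts_left C k t (?a @ w @ ?b @ v)"
    | (a) "\<not> acts_left C k t (?a @ w @ ?b @ v)" "acts_left C k ?a (w @ ?b @ v)"
    | (w) "\<not> acts_left C k t (?a @ w @ ?b @ v)" "\<not> acts_left C k ?a (w @ ?b @ v)" "acts_left C k w (?b @ v)"
    | (b) "\<not> acts_left C k t (?a @ w @ ?b @ v)" "\<not> acts_left C k ?a (w @ ?b @ v)" "\<not> acts_left C k w (?b @ v)"
      "acts_left C k ?b v"
    | (v) "\<not> acts_left C k t (?a @ w @ ?b @ v)" "\<not> acts_left C k ?a (w @ ?b @ v)" "\<not> acts_left C k w (?b @ v)"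
      "\<not> acts_left C k ?b v" by blast
  then show thesis
  proof cases
    case t
    then obtain t' where t': "act_word k t = Some t'"
      using n1 by (auto simp: act_free_append)
    have "acts_left C k t (?a @ w)" using t anti[of t "?a @ w" "?b @ v"] by simp
    then show thesis
      by (intro that[of t' \<alpha> w \<beta> v]) (use t t' e1 e2 e4 B in \<open>simp_all add: step_image_def act_free_append\<close>)
  next
    case a
    then obtain a' where "act_word k ?a = Some a'"
      using n1 by (auto simp: act_free_append)
    then obtain \<alpha>' where \<alpha>': "act_srule C X k \<alpha> = Some \<alpha>'"
      "act_word k ?a = Some (rule_src \<alpha>')" "act_word k ?a' = Some (rule_tgt \<alpha>')"
      by (metis act_srule_Some mem(2))
    have "acts_left C k ?a w" using a(2) by (rule anti)
    \<comment> \<open>As right context of \<open>t\<close>, both \<open>?a @ w\<close> and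
      \<open>?a @ w @ ?b @ v\<close> count as \<open>?a\<close> alone.\<close>
    moreover have "\<not> acts_left C k t (?a @ w)"
      using a absorb[OF a(2), of t] absorb[OF \<open>acts_left C k ?a w\<close>, of t] by simp
    ultimately show thesis
      by (intro that[of t \<alpha>' w \<beta> v]) (use a \<alpha>' e1 e2 e4 B in \<open>simp_all add: step_image_def act_free_append\<close>)
  next
    case w
    then obtain w' where w': "act_word k w = Some w'"
      using n1 by (auto simp: act_free_append)
    have "\<not> acts_left C k ?a w" "\<not> acts_left C k t (?a @ w)"
      using w absorb[OF w(3), of ?a] absorb[of "?a @ w" "?b @ v" t]
      by (simp_all add: acts_left_append_left)
    then show thesis
      by (intro that[of t \<alpha> w' \<beta> v]) (use w w' e1 e2 e4 B in \<open>simp_all add: step_image_def act_free_append\<close>)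
  next
    case b
    then obtain b' where "act_word k ?b = Some b'"
      using n1 by (auto simp: act_free_append)
    then obtain \<beta>' where \<beta>': "act_srule C X k \<beta> = Some \<beta>'"
      "act_word k ?b = Some (rule_src \<beta>')" "act_word k ?b' = Some (rule_tgt \<beta>')"
      by (metis act_srule_Some mem(4))
    show thesis
      by (intro that[of t \<alpha> w \<beta>' v]) (use b \<beta>' e1 e2 e4 B in \<open>simp_all add: step_image_def act_free_append\<close>)
  next
    case v
    then obtain v' where v': "act_word k v = Some v'"
      using n1 by (auto simp: act_free_append)
    show thesis
      by (intro that[of t \<alpha> w \<beta> v']) (use v v' e1 e2 e4 B in \<open>simp_all add: step_image_def act_free_append\<close>)
  qed
qed

section \<open>The operators on congruence classes\<close>

lemma congr_image:
  "congr X p q \<Longrightarrow> act_word k (fst p) = Some u \<Longrightarrow>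
     congr X (u, map (step_image k) (snd p)) (u, map (step_image k) (snd q))"
proof (induction rule: congr.induct)
  case (refl p)
  then show ?case
    using path_image[of "fst p" "snd p" k u]
    by (intro congr.refl) (auto simp: composites_def)
next
  case (sym p q)
  have "fst p = fst q" using congr_composites[OF sym.hyps] by simp
  then show ?case using sym.prems by (intro congr.sym[OF sym.IH]) simp
next
  case (trans p q r)
  have "fst p = fst q" using congr_composites[OF trans.hyps(1)] by simp
  then show ?case using trans.prems by (intro congr.trans[OF trans.IH]) simp_all
next
  case (exchange s xs t \<alpha> w \<beta> v ys)
  let ?old = "[(t, \<alpha>, w @ rule_src \<beta> @ v), (t @ rule_tgt \<alpha> @ w, \<beta>, v)]"
  let ?im = "step_image k"
  have path: "path_from X s (xs @ ?old @ ys)" and s: "act_word k s = Some u"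
    using exchange by (simp_all add: composites_def)
  have old: "path_from X (composite_tgt (s, xs)) (?old @ ys)" by (rule path_from_appendD[OF path])
  then have mem: "t \<in> lists (gens X)" "\<alpha> \<in> signed_rules X" "w \<in> lists (gens X)"
    "\<beta> \<in> signed_rules X" "v \<in> lists (gens X)"
    and m: "composite_tgt (s, xs) = t @ rule_src \<alpha> @ w @ rule_src \<beta> @ v"
    by (auto simp: steps_def)
  have "path_from X s xs"
    using path by (induction xs arbitrary: s) (auto simp: steps_def dest: srule_words)
  from path_image[OF this s]
  have "act_word k (t @ rule_src \<alpha> @ w @ rule_src \<beta> @ v) = Some (composite_tgt (u, map ?im xs))"
    unfolding m by blast
  then obtain t' \<alpha>' w' \<beta>' v' where im:
    "?im (t, \<alpha>, w @ rule_src \<beta> @ v) = (t', \<alpha>', w' @ rule_src \<beta>' @ v')"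
    "?im (t @ rule_tgt \<alpha> @ w, \<beta>, v) = (t' @ rule_tgt \<alpha>' @ w', \<beta>', v')"
    "?im (t @ rule_src \<alpha> @ w, \<beta>, v) = (t' @ rule_src \<alpha>' @ w', \<beta>', v')"
    "?im (t, \<alpha>, w @ rule_tgt \<beta> @ v) = (t', \<alpha>', w' @ rule_tgt \<beta>' @ v')"
    by (rule exchange_image[OF mem])
  have "path_from X u (map ?im (xs @ ?old @ ys))" using path_image[OF path s] by blast
  then have "(u, map ?im xs @ [(t', \<alpha>', w' @ rule_src \<beta>' @ v'), (t' @ rule_tgt \<alpha>' @ w', \<beta>', v')]
      @ map ?im ys) \<in> composites X"
    using im by (simp add: composites_def)
  from congr.exchange[OF this] show ?case using im by simp
next
  case (inverse s xs t \<alpha> v ys)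
  let ?old = "[(t, \<alpha>, v), (t, rule_inv \<alpha>, v)]"
  let ?im = "step_image k"
  have path: "path_from X s (xs @ ?old @ ys)" and s: "act_word k s = Some u"
    using inverse by (simp_all add: composites_def)
  have old: "path_from X (composite_tgt (s, xs)) (?old @ ys)" by (rule path_from_appendD[OF path])
  then have mem: "t \<in> lists (gens X)" "\<alpha> \<in> signed_rules X" "v \<in> lists (gens X)"
    and m: "composite_tgt (s, xs) = t @ rule_src \<alpha> @ v"
    by (auto simp: steps_def)
  have "path_from X s xs"
    using path by (induction xs arbitrary: s) (auto simp: steps_def dest: srule_words)
  from path_image[OF this s]
  have n: "act_word k (t @ rule_src \<alpha> @ v) \<noteq> None"
    unfolding m by simp
  have refl: "same_strings C x x" for x by (simp add: same_strings_def)
  note ss = refl srule_same_strings[OF mem(2)] same_strings_append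
  have n': "act_word k (t @ rule_tgt \<alpha> @ v) \<noteq> None"
    using n act_free_None_same_strings[of "t @ rule_src \<alpha> @ v" "t @ rule_tgt \<alpha> @ v" k]
    by (simp add: ss)
  have A: "acts_left C k t (rule_tgt \<alpha> @ v) \<longleftrightarrow> acts_left C k t (rule_src \<alpha> @ v)"
    "acts_left C k (rule_tgt \<alpha>) v \<longleftrightarrow> acts_left C k (rule_src \<alpha>) v"
    by (rule acts_left_same_strings[symmetric]; intro ss)+
  \<comment> \<open>The image of an inverse pair is an inverse pair: either the rule moves, and the
    operator commutes with \<open>rule_inv\<close>, or the same whisker moves in both steps.\<close>
  have "\<exists>t' \<alpha>' v'. ?im (t, \<alpha>, v) = (t', \<alpha>', v') \<and> ?im (t, rule_inv \<alpha>, v) = (t', rule_inv \<alpha>', v')"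
  proof (cases "\<not> acts_left C k t (rule_src \<alpha> @ v) \<and> acts_left C k (rule_src \<alpha>) v")
    case True
    then obtain a' where "act_word k (rule_src \<alpha>) = Some a'"
      using n by (auto simp: act_free_append)
    then obtain \<alpha>' where "act_srule C X k \<alpha> = Some \<alpha>'" "act_srule C X k (rule_inv \<alpha>) = Some (rule_inv \<alpha>')"
      by (metis act_srule_Some mem(2))
    then show ?thesis using True A act_step_eq[of k t \<alpha> v] act_step_eq[of k t "rule_inv \<alpha>" v] n n'
      by (simp add: step_image_def)
  next
    case False
    then have "(acts_left C k t (rule_src \<alpha> @ v) \<and> act_word k t \<noteq> None) \<or>
        (\<not> acts_left C k t (rule_src \<alpha> @ v) \<and> \<not> acts_left C k (rule_src \<alpha>) v \<and> act_word k v \<noteq> None)"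
      using n by (auto simp: act_free_append split: if_splits)
    then show ?thesis using A act_step_eq[of k t \<alpha> v] act_step_eq[of k t "rule_inv \<alpha>" v] n n'
      by (auto simp: step_image_def)
  qed
  then obtain t' \<alpha>' v' where im: "?im (t, \<alpha>, v) = (t', \<alpha>', v')"
    "?im (t, rule_inv \<alpha>, v) = (t', rule_inv \<alpha>', v')" by blast
  have "path_from X u (map ?im (xs @ ?old @ ys))" using path_image[OF path s] by blast
  then have "(u, map ?im xs @ [(t', \<alpha>', v'), (t', rule_inv \<alpha>', v')] @ map ?im ys) \<in> composites X"
    using im by (simp add: composites_def)
  from congr.inverse[OF this] show ?case using im by simp
qed

lemma act_cell_eq:
  assumes "\<gamma> \<in> cells X" "p \<in> \<gamma>" "act_word k (fst p) = Some u"
  shows "act_cell C X k \<gamma> = Some (congr_rel X `` {(u, map (step_image k) (snd p))})"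
proof -
  have "congr_rel X `` {q. \<exists>p\<in>\<gamma>. act_composite C X k p = Some q} =
    congr_rel X `` {(u, map (step_image k) (snd p))}"
  proof (rule class_of_set)
    show "(u, map (step_image k) (snd p)) \<in> {q. \<exists>p\<in>\<gamma>. act_composite C X k p = Some q}"
      using assms(2,3) by (auto simp: act_composite_def step_image_def)
  next
    fix q assume "q \<in> {q. \<exists>p\<in>\<gamma>. act_composite C X k p = Some q}"
    then obtain p' where p': "p' \<in> \<gamma>" "act_composite C X k p' = Some q" by blast
    have c: "congr X p p'" using cell_congr[OF assms(1,2) p'(1)] .
    then have "fst p' = fst p" using congr_composites by metis
    then have "q = (u, map (step_image k) (snd p'))"
      using p'(2) assms(3) by (simp add: act_composite_def step_image_def)
    then show "congr X (u, map (step_image k) (snd p)) q"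
      using congr_image[OF c assms(3)] by simp
  qed
  then show ?thesis
    using assms(3) cell_src_eq[OF assms(1,2)] by (simp add: act_cell_def)
qed

lemma act_vcomp:
  assumes "\<gamma> \<in> cells X" "\<delta> \<in> cells X" "cell_tgt \<gamma> = cell_src \<delta>"
    and "act_cell C X k \<gamma> = Some \<gamma>'" "act_cell C X k \<delta> = Some \<delta>'"
  shows "act_cell C X k (vcomp X \<gamma> \<delta>) = Some (vcomp X \<gamma>' \<delta>')"
proof -
  obtain p q where pq: "p \<in> \<gamma>" "q \<in> \<delta>"
    using cell_nonempty[OF assms(1)] cell_nonempty[OF assms(2)] by metis
  have tgt: "composite_tgt p = fst q"
    using assms pq by (simp add: cell_src_eq[OF _ pq(2)] cell_tgt_eq[OF _ pq(1)])
  have paths: "path_from X (fst p) (snd p)" "path_from X (fst q) (snd q)"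
    using cell_composite[OF assms(1) pq(1)] cell_composite[OF assms(2) pq(2)]
    by (auto simp: composites_def)
  obtain u v where u: "act_word k (fst p) = Some u" and v: "act_word k (fst q) = Some v"
    using assms(4,5) cell_src_eq[OF assms(1) pq(1)] cell_src_eq[OF assms(2) pq(2)]
    by (auto simp: act_cell_def split: if_splits)
  let ?p = "(u, map (step_image k) (snd p))" and ?q = "(v, map (step_image k) (snd q))"
  let ?r = "(fst p, snd p @ snd q)"
  have \<gamma>': "\<gamma>' = congr_rel X `` {?p}" and \<delta>': "\<delta>' = congr_rel X `` {?q}"
    using act_cell_eq[OF assms(1) pq(1) u] act_cell_eq[OF assms(2) pq(2) v] assms(4,5) by simp_all
  have pc: "?p \<in> composites X" "?q \<in> composites X" and tgt': "composite_tgt ?p = fst ?q"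
    using path_image[OF paths(1) u] path_image[OF paths(2) v] tgt v by (simp_all add: composites_def)
  have vc: "vcomp X \<gamma>' \<delta>' = congr_rel X `` {(fst ?p, snd ?p @ snd ?q)}"
    unfolding \<gamma>' \<delta>' by (rule vcomp_eq_class[OF _ _ _ _ tgt'])
      (use pc class_in_cells class_self in auto)
  have v: "vcomp X \<gamma> \<delta> = congr_rel X `` {?r}" by (rule vcomp_eq_class[OF assms(1,2) pq tgt])
  have r: "?r \<in> composites X"
    using congr_vcomp[OF cell_congr[OF assms(1) pq(1,1)] cell_congr[OF assms(2) pq(2,2)] tgt]
      congr_composites by blast
  show ?thesis
    unfolding vc using act_cell_eq[of "vcomp X \<gamma> \<delta>" ?r k u] u class_in_cells[OF r] class_self[OF r]
    by (simp add: v)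
qed

lemma act_step_cell:
  assumes "s \<in> steps X" "act_word k (step_src s) = Some u"
  shows "act_cell C X k (step_cell X s) = Some (step_cell X (step_image k s))"
  using act_cell_eq[of "step_cell X s" "(step_src s, [s])" k u] step_cell[OF assms(1)] assms(2)
    step_image[OF assms]
  by (simp add: step_cell_def)

end

section \<open>Words and columns of classical type\<close>

text \<open>Despite the name this is the largest index of a letter: it is 3 in type G2, which has
  only two simple roots.\<close>

fun lie_rank :: "cartan_type \<Rightarrow> nat" where
  "lie_rank (TypeA n) = n"
| "lie_rank (TypeB n) = n"
| "lie_rank (TypeC n) = n"
| "lie_rank (TypeD n) = n"
| "lie_rank TypeG2 = 3"

text \<open>\<open>n\<close> is the largest index of a letter; the doubling leaves room for \<open>Zero\<close>.\<close>

fun height :: "nat \<Rightarrow> letter \<Rightarrow> nat" where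
  "height n (Pos j) = 2 * j"
| "height n Zero = 2 * n + 1"
| "height n (Bar j) = 4 * n + 2 - 2 * j"

lemma arrow_height:
  "classical_type T \<Longrightarrow> arrow T i x y \<Longrightarrow>
     height (lie_rank T) x < height (lie_rank T) y \<and> height (lie_rank T) y \<le> 4 * lie_rank T + 2"
  by (cases T) auto

lemma arrow_functional: "arrow T i x y \<Longrightarrow> arrow T i x y' \<Longrightarrow> y = y'"
  by (cases T) (simp_all, (elim disjE conjE; simp)+)

lemma arrow_injective: "arrow T i x y \<Longrightarrow> arrow T i x' y \<Longrightarrow> x = x'"
  by (cases T) (simp_all, (elim disjE conjE; simp)+)

lemma letter_f_Some: "letter_f T i x = Some y \<longleftrightarrow> arrow T i x y"
proof -
  have "(THE y. arrow T i x y) = y" if "arrow T i x y" for y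
    by (rule the_equality, rule that) (rule arrow_functional[OF _ that])
  then show ?thesis by (auto simp: letter_f_def)
qed

lemma letter_e_Some: "letter_e T i y = Some x \<longleftrightarrow> arrow T i x y"
proof -
  have "(THE x. arrow T i x y) = x" if "arrow T i x y" for x
    by (rule the_equality, rule that) (rule arrow_injective[OF _ that])
  then show ?thesis by (auto simp: letter_e_def)
qed

primrec inverse_operator :: "kashiwara \<Rightarrow> kashiwara" where
  "inverse_operator (E i) = F i"
| "inverse_operator (F i) = E i"

lemma (in ranked_crystal) act_inverse: "act C k x = Some y \<Longrightarrow> act C (inverse_operator k) y = Some x"
  by (cases k) (auto simp: ff_iff_ee)

section \<open>Plactic equivalence and normal forms\<close>

lemma plactic_sym: "plactic T w w' \<Longrightarrow> plactic T w' w"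
  unfolding plactic_iff_bisimilar using bisimilar_sym[of "words T" w w'] by simp

lemma plactic_trans: "plactic T w w' \<Longrightarrow> plactic T w' w'' \<Longrightarrow> plactic T w w''"
  unfolding plactic_iff_bisimilar using bisimilar_trans[of "words T" w w' w''] by simp

lemma Pc_SomeD:
  assumes "Pc T w = Some t"
  shows "t \<in> tableaux T \<and> plactic T (concat t) w"
    and "t' \<in> tableaux T \<Longrightarrow> plactic T (concat t') w \<Longrightarrow> t' = t"
proof -
  have ex: "\<exists>!t. t \<in> tableaux T \<and> plactic T (concat t) w"
    and t: "t = (THE t. t \<in> tableaux T \<and> plactic T (concat t) w)"
    using assms by (auto simp: Pc_def split: if_splits)
  show 1: "t \<in> tableaux T \<and> plactic T (concat t) w"
    unfolding t by (rule theI'[OF ex])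
  show "t' \<in> tableaux T \<Longrightarrow> plactic T (concat t') w \<Longrightarrow> t' = t"
    using ex 1 by blast
qed

lemma Pc_cong:
  assumes "plactic T w w'"
  shows "Pc T w = Pc T w'"
proof -
  have "plactic T v w \<longleftrightarrow> plactic T v w'" for v
    using plactic_trans[OF _ assms] plactic_trans[OF _ plactic_sym[OF assms]] by iprover
  then show ?thesis by (simp add: Pc_def)
qed

section \<open>Letters, words, columns and words in columns of a fixed type\<close>

locale classical =
  fixes T :: cartan_type
  assumes classical: "classical_type T"
begin

lemma ranked_letters: "ranked_crystal (letters T)"
proof
  show "ff (letters T) i x = Some y \<longleftrightarrow> ee (letters T) i y = Some x" for i x y
    by (simp add: letters_def letter_f_Some letter_e_Some)
  show "\<exists>r :: letter \<Rightarrow> nat. \<forall>i x y. ee (letters T) i x = Some y \<longrightarrow> r y < r x"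
    using arrow_height[OF classical]
    by (intro exI[of _ "height (lie_rank T)"]) (auto simp: letters_def letter_e_Some)
  \<comment> \<open>Lowering increases the height, so its complement with respect to the upper bound
    from \<open>arrow_height\<close> is the rank for \<open>ff\<close>.\<close>
  have "4 * lie_rank T + 2 - height (lie_rank T) y < 4 * lie_rank T + 2 - height (lie_rank T) x"
    if "arrow T i x y" for i x y
    using arrow_height[OF classical that] by linarith
  then show "\<exists>r :: letter \<Rightarrow> nat. \<forall>i x y. ff (letters T) i x = Some y \<longrightarrow> r y < r x"
    by (intro exI[of _ "\<lambda>x. 4 * lie_rank T + 2 - height (lie_rank T) x"])
      (auto simp: letters_def letter_f_Some)
qed

sublocale letters: ranked_crystal "letters T"
  by (rule ranked_letters)

sublocale words: ranked_crystal "words T"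
  unfolding words_def by (rule letters.ranked_free_crystal)

lemma elts_words: "elts (words T) = lists (alphabet T)"
  by (simp add: words_def elts_free_crystal letters_def)

lemma columns_simps:
  "ee (columns T) = ee (words T)" "ff (columns T) = ff (words T)"
  by (simp_all add: columns_def)

text \<open>The crystal of columns differs from that of words only in \<open>elts\<close>, and the
  axioms constrain the operators alone.\<close>

sublocale columns: ranked_crystal "columns T"
  using words.ranked_crystal_axioms unfolding ranked_crystal_def columns_simps .

lemma act_columns: "act (columns T) k c = act (words T) k c"
  by (cases k) (simp_all add: columns_simps)

lemma eps_columns: "eps (columns T) i c = word_eps (letters T) i c"
  by (simp add: eps_def columns_simps words_def flip: letters.free_eps)

lemma phi_columns: "phi (columns T) i c = word_phi (letters T) i c"
  by (simp add: phi_def columns_simps words_def flip: letters.free_phi)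

lemma hw_columns_subset: "hw_columns T \<subseteq> elts (columns T)"
  using component_refl by (fastforce simp: columns_def)

lemma act_columns_closed: "c \<in> elts (columns T) \<Longrightarrow> act (columns T) k c = Some d \<Longrightarrow> d \<in> elts (columns T)"
  by (auto simp: columns_def act_columns[unfolded columns_def] dest: component_act)

lemma act_column_words_closed:
  "u \<in> lists (elts (columns T)) \<Longrightarrow> act (free_crystal (columns T)) k u = Some v \<Longrightarrow>
     v \<in> lists (elts (columns T))"
  by (rule columns.act_free_closed) (rule act_columns_closed)

lemma word_eps_columns: "word_eps (columns T) i u = word_eps (letters T) i (concat u)"
  and word_phi_columns: "word_phi (columns T) i u = word_phi (letters T) i (concat u)"
proof -
  have "word_eps (columns T) i u = word_eps (letters T) i (concat u) \<and>
    word_phi (columns T) i u = word_phi (letters T) i (concat u)"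
    by (induction u) (simp_all add: eps_columns phi_columns word_eps_append word_phi_append)
  then show "word_eps (columns T) i u = word_eps (letters T) i (concat u)"
    "word_phi (columns T) i u = word_phi (letters T) i (concat u)" by simp_all
qed

text \<open>Associativity of the tensor product: a word in columns is a bracketed word in letters. A
  column has the string lengths of its underlying word, so at each column the two levels perform the
  same test.\<close>

lemma act_concat:
  "act (words T) k (concat u) = map_option concat (act (free_crystal (columns T)) k u)"
proof (induction u)
  case (Cons c u)
  have left: "acts_left (columns T) k [c] u \<longleftrightarrow> acts_left (letters T) k c (concat u)"
    by (cases k) (simp_all add: word_eps_columns phi_columns)
  have singleton: "(@) [c] = (#) c" by (rule ext) simp
  have "act (free_crystal (columns T)) k ([c] @ u) =
      (if acts_left (letters T) k c (concat u) then map_option (\<lambda>c'. c' # u) (act (words T) k c)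
       else map_option (\<lambda>u'. c # u') (act (free_crystal (columns T)) k u))"
    unfolding columns.act_free_append left
    by (simp add: columns.act_free_singleton option.map_comp comp_def act_columns singleton)
  moreover have "act (words T) k (c @ concat u) =
      (if acts_left (letters T) k c (concat u) then map_option (\<lambda>c'. c' @ concat u) (act (words T) k c)
       else map_option (\<lambda>w. c @ w) (act (words T) k (concat u)))"
    unfolding words_def by (rule letters.act_free_append)
  ultimately show ?case by (simp add: Cons.IH option.map_comp comp_def)
qed (simp add: words_def)

lemma tableaux_columns: "t \<in> tableaux T \<Longrightarrow> t \<in> lists (elts (columns T))"
proof -
  assume "t \<in> tableaux T"
  then obtain h where h: "h \<in> hw_tableaux T" and t: "t \<in> elts (component (free_crystal (columns T)) h)"
    by (auto simp: tableaux_def)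
  show ?thesis
    using t
  proof (induction rule: component_induct)
    case refl
    then show ?case using h hw_columns_subset by (auto simp: hw_tableaux_def)
  next
    case (act a b k)
    then show ?case using act_column_words_closed by blast
  qed
qed

lemma tableaux_act:
  "t \<in> tableaux T \<Longrightarrow> act (free_crystal (columns T)) k t = Some t' \<Longrightarrow> t' \<in> tableaux T"
  unfolding tableaux_def using component_act[of t "free_crystal (columns T)"] by blast

lemma plactic_append:
  "plactic T u u' \<Longrightarrow> plactic T v v' \<Longrightarrow> plactic T (u @ v) (u' @ v')"
  unfolding plactic_iff_bisimilar elts_words
  using letters.bisimilar_append[of u u' v v'] by (simp add: words_def)

lemma plactic_refl: "w \<in> elts (words T) \<Longrightarrow> plactic T w w"
  by (simp add: plactic_iff_bisimilar bisimilar_refl)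

lemma plactic_same_strings:
  "plactic T (concat u) (concat v) \<Longrightarrow> same_strings (columns T) u v"
  using letters.bisimilar_same_strings[of "concat u" "concat v"]
  by (simp add: plactic_iff_bisimilar words_def same_strings_def word_eps_columns word_phi_columns)

end

text \<open>
  That every word in columns has a normal form is read off from the existence of a
  normalization strategy, so the theory of the plactic monoid is not needed for it.
\<close>

locale column_strategy = classical +
  fixes \<sigma> :: "column list \<Rightarrow> column cell"
  assumes strategy: "crystal_normalization_strategy T \<sigma>"
begin

abbreviation column_words :: "column list set" where
  "column_words \<equiv> lists (elts (columns T))"

abbreviation act_col :: "kashiwara \<Rightarrow> column list \<Rightarrow> column list option" where
  "act_col \<equiv> act (free_crystal (columns T))"

lemma gens_Col [simp]: "gens (Col T) = elts (columns T)"
  by (simp add: Col_def)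

lemma \<sigma>:
  assumes "u \<in> column_words"
  shows "\<sigma> u \<in> cells (Col T)" "cell_src (\<sigma> u) = u" "Pc T (concat u) = Some (cell_tgt (\<sigma> u))"
  using strategy assms
  by (auto simp: crystal_normalization_strategy_def normalization_strategy_def)

lemma \<sigma>_act:
  "u \<in> column_words \<Longrightarrow> act_col k u = Some u' \<Longrightarrow>
     act_cell (columns T) (Col T) k (\<sigma> u) = Some (\<sigma> u')"
  using strategy by (simp add: crystal_normalization_strategy_def)

lemma Pc_exists:
  assumes "u \<in> column_words"
  obtains t where "Pc T (concat u) = Some t" "t \<in> tableaux T" "t \<in> column_words"
    "plactic T (concat t) (concat u)"
  using \<sigma>(3)[OF assms] Pc_SomeD(1)[OF \<sigma>(3)[OF assms]] tableaux_columns by blast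

text \<open>Membership of both words is part of \<open>plactic\<close>, and each word in columns is
  plactically equivalent to its normal form.\<close>

lemma concat_in_words: "u \<in> column_words \<Longrightarrow> concat u \<in> elts (words T)"
  using Pc_exists plactic_iff_bisimilar by metis

text \<open>The plactic equivalence transports the operator from \<open>u\<close> to
  \<open>t\<close>, and the image of \<open>t\<close> stays in its component, hence is a tableau. It
  is equivalent to the new word, whose normal form exists by the strategy at \<open>u'\<close>, so
  uniqueness identifies the two.\<close>

lemma Pc_act:
  assumes u: "u \<in> column_words" and act: "act_col k u = Some u'" and t: "Pc T (concat u) = Some t"
  obtains t' where "act_col k t = Some t'" "Pc T (concat u') = Some t'"
proof -
  have tab: "t \<in> tableaux T" and sim: "plactic T (concat t) (concat u)"
    using Pc_SomeD(1)[OF t] by simp_all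
  have u': "u' \<in> column_words" by (rule act_column_words_closed[OF u act])
  have "act (words T) k (concat u) = Some (concat u')" using act by (simp add: act_concat)
  then obtain w where w: "act (words T) k (concat t) = Some w" "bisimilar (words T) (concat u') w"
    using bisimilar_act[of "words T" "concat u" "concat t" k "concat u'"] plactic_sym[OF sim]
    by (auto simp: plactic_iff_bisimilar)
  then obtain t' where t': "act_col k t = Some t'" "w = concat t'"
    by (auto simp: act_concat)
  have tab': "t' \<in> tableaux T" by (rule tableaux_act[OF tab t'(1)])
  have "plactic T (concat t') (concat u')"
    unfolding plactic_iff_bisimilar
    using concat_in_words[OF u'] concat_in_words[OF tableaux_columns[OF tab']]
      bisimilar_sym[OF w(2)] t'(2) by simp
  then have "Pc T (concat u') = Some t'"
    using Pc_SomeD(2)[OF \<sigma>(3)[OF u']] tab' \<sigma>(3)[OF u'] by simp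
  then show thesis using t'(1) that by blast
qed

lemma rules_Col: "(s, t) \<in> rules (Col T) \<longleftrightarrow>
    s \<in> column_words \<and> length s = 2 \<and> Pc T (concat s) = Some t \<and> t \<noteq> s"
  by (auto simp: Col_def length_Suc_conv numeral_2_eq_2)

sublocale crystal_polygraph "columns T" "Col T"
proof
  fix s t assume st: "(s, t) \<in> rules (Col T)"
  then have s: "s \<in> column_words" "length s = 2" "Pc T (concat s) = Some t" "t \<noteq> s"
    by (simp_all add: rules_Col)
  note t = Pc_SomeD(1)[OF s(3)]
  show "s \<in> lists (gens (Col T)) \<and> t \<in> lists (gens (Col T))"
    using s(1) t tableaux_columns by simp
  show "t = t'" if "(s, t') \<in> rules (Col T)" for t'
    using that s(3) by (simp add: rules_Col)
  show "same_strings (columns T) s t"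
    by (rule same_strings_sym, rule plactic_same_strings) (use t in simp)
  show "\<exists>t'. act_col k t = Some t' \<and> (s', t') \<in> rules (Col T)"
    if act: "act_col k s = Some s'" for k s'
  proof -
    interpret free: ranked_crystal "free_crystal (columns T)"
      by (rule columns.ranked_free_crystal)
    obtain t' where t': "act_col k t = Some t'" "Pc T (concat s') = Some t'"
      by (rule Pc_act[OF s(1) act s(3)])
    \<comment> \<open>If the images coincided, the inverse operator would take them back to one
      word, contrary to \<open>t \<noteq> s\<close>.\<close>
    have "t' \<noteq> s'"
      using free.act_inverse[OF act] free.act_inverse[OF t'(1)] s(4) by auto
    then show ?thesis
      using t' act_column_words_closed[OF s(1) act] columns.act_free_length[OF act] s(2)
      by (simp add: rules_Col)
  qed
next
  show "y \<in> gens (Col T)" if "x \<in> gens (Col T)" "act (columns T) k x = Some y" for x k y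
    using that act_columns_closed by simp
qed

section \<open>Critical branchings and their spheres\<close>

lemma critical_steps:
  assumes "critical T c1 c2 c3"
  shows "left_step T c1 c2 c3 \<in> steps (Col T)" "right_step T c1 c2 c3 \<in> steps (Col T)"
    "step_src (left_step T c1 c2 c3) = [c1, c2, c3]" "step_src (right_step T c1 c2 c3) = [c1, c2, c3]"
proof -
  have c: "[c1, c2] \<in> column_words" "[c2, c3] \<in> column_words"
    using assms by (simp_all add: critical_def)
  have "([c1, c2], the (Pc T (c1 @ c2))) \<in> rules (Col T)"
    "([c2, c3], the (Pc T (c2 @ c3))) \<in> rules (Col T)"
    using assms c \<sigma>(3)[OF c(1)] \<sigma>(3)[OF c(2)] by (auto simp: rules_Col critical_def)
  then show "left_step T c1 c2 c3 \<in> steps (Col T)" "right_step T c1 c2 c3 \<in> steps (Col T)"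
    using c by (auto simp: left_step_def right_step_def steps_def signed_rules_def)
qed (simp_all add: left_step_def right_step_def)

text \<open>Criticality of the image is read off from the images of the two rewriting steps: these
  are again forward steps of the same shape, so \<open>[d1, d2]\<close> and \<open>[d2, d3]\<close>
  are sources of rules.\<close>

lemma critical_act:
  assumes crit: "critical T c1 c2 c3" and act: "act_col k [c1, c2, c3] = Some u"
  obtains d1 d2 d3 where "u = [d1, d2, d3]" "critical T d1 d2 d3"
    "step_image k (left_step T c1 c2 c3) = left_step T d1 d2 d3"
    "step_image k (right_step T c1 c2 c3) = right_step T d1 d2 d3"
proof -
  have u: "u \<in> column_words"
    by (rule act_column_words_closed[OF _ act]) (use crit in \<open>simp add: critical_def\<close>)
  obtain d1 d2 d3 where d: "u = [d1, d2, d3]"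
    using columns.act_free_length[OF act] by (auto simp: length_Suc_conv)
  have rule: "x = [a, b] \<and> Pc T (a @ b) \<noteq> Some [a, b] \<and> y = the (Pc T (a @ b))"
    if "(x, y) \<in> rules (Col T)" "x = [a, b]" for x y a b
    using that by (simp add: rules_Col)
  let ?l = "([], Fwd ([c1, c2], the (Pc T (c1 @ c2))), [c3])"
  have l_step: "?l \<in> steps (Col T)" and l_src: "act_col k (step_src ?l) = Some u"
    using critical_steps(1)[OF crit] act by (simp_all add: left_step_def)
  obtain t \<alpha> v where l: "act_step (columns T) (Col T) k ?l = Some (t, \<alpha>, v)"
    "(t, \<alpha>, v) \<in> steps (Col T)" "step_src (t, \<alpha>, v) = u"
    "act_col k (step_tgt ?l) = Some (step_tgt (t, \<alpha>, v))"
    "length t = length ([] :: column list)" "length v = length [c3]"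
    "(\<exists>r. Fwd ([c1, c2], the (Pc T (c1 @ c2))) = Fwd r) \<longleftrightarrow> (\<exists>r. \<alpha> = Fwd r)"
    by (rule act_step_Some[OF l_step l_src])
  then obtain x y where x: "\<alpha> = Fwd (x, y)" "(x, y) \<in> rules (Col T)"
    by (auto simp: steps_def signed_rules_def)
  \<comment> \<open>The source of a rule has length 2, so the whisker lengths 0 and 1 leave only one
    factorization of \<open>u\<close>. The other step is identified in the same way.\<close>
  have xv: "x = [d1, d2]" "v = [d3]" "t = []"
    using l x d by (auto simp: rules_Col length_Suc_conv numeral_2_eq_2)
  let ?r = "([c1], Fwd ([c2, c3], the (Pc T (c2 @ c3))), [])"
  have r_step: "?r \<in> steps (Col T)" and r_src: "act_col k (step_src ?r) = Some u"
    using critical_steps(2)[OF crit] act by (simp_all add: right_step_def)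
  obtain t2 \<alpha>2 v2 where r: "act_step (columns T) (Col T) k ?r = Some (t2, \<alpha>2, v2)"
    "(t2, \<alpha>2, v2) \<in> steps (Col T)" "step_src (t2, \<alpha>2, v2) = u"
    "act_col k (step_tgt ?r) = Some (step_tgt (t2, \<alpha>2, v2))"
    "length t2 = length [c1]" "length v2 = length ([] :: column list)"
    "(\<exists>r. Fwd ([c2, c3], the (Pc T (c2 @ c3))) = Fwd r) \<longleftrightarrow> (\<exists>r. \<alpha>2 = Fwd r)"
    by (rule act_step_Some[OF r_step r_src])
  then obtain x2 y2 where x2: "\<alpha>2 = Fwd (x2, y2)" "(x2, y2) \<in> rules (Col T)"
    by (auto simp: steps_def signed_rules_def)
  have xv2: "x2 = [d2, d3]" "v2 = []" "t2 = [d1]"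
    using r x2 d by (auto simp: rules_Col length_Suc_conv numeral_2_eq_2)
  show thesis
  proof (rule that[OF d])
    show "critical T d1 d2 d3"
      using u d rule[OF x(2) xv(1)] rule[OF x2(2) xv2(1)] by (simp add: critical_def)
    show "step_image k (left_step T c1 c2 c3) = left_step T d1 d2 d3"
      using l(1) x(1) xv rule[OF x(2) xv(1)] by (simp add: step_image_def left_step_def)
    show "step_image k (right_step T c1 c2 c3) = right_step T d1 d2 d3"
      using r(1) x2(1) xv2 rule[OF x2(2) xv2(1)] by (simp add: step_image_def right_step_def)
  qed
qed

text \<open>Both halves of a sphere have this form, a step followed by the strategy at its target,
  so one lemma serves for both.\<close>

lemma step_strategy_cell:
  assumes "s \<in> steps (Col T)"
  shows "vcomp (Col T) (step_cell (Col T) s) (\<sigma> (step_tgt s)) \<in> cells (Col T)"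
    "cell_src (vcomp (Col T) (step_cell (Col T) s) (\<sigma> (step_tgt s))) = step_src s"
    "Pc T (concat (step_tgt s)) =
       Some (cell_tgt (vcomp (Col T) (step_cell (Col T) s) (\<sigma> (step_tgt s))))"
proof -
  have tgt: "step_tgt s \<in> column_words" using step_tgt_words[OF assms] by simp
  show "vcomp (Col T) (step_cell (Col T) s) (\<sigma> (step_tgt s)) \<in> cells (Col T)"
    "cell_src (vcomp (Col T) (step_cell (Col T) s) (\<sigma> (step_tgt s))) = step_src s"
    "Pc T (concat (step_tgt s)) =
       Some (cell_tgt (vcomp (Col T) (step_cell (Col T) s) (\<sigma> (step_tgt s))))"
    using vcomp_cell[of "step_cell (Col T) s" "\<sigma> (step_tgt s)"] step_cell[OF assms] \<sigma>[OF tgt]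
    by simp_all
qed

lemma act_step_strategy_cell:
  assumes "s \<in> steps (Col T)" "act_col k (step_src s) = Some u"
  shows "act_cell (columns T) (Col T) k (vcomp (Col T) (step_cell (Col T) s) (\<sigma> (step_tgt s))) =
    Some (vcomp (Col T) (step_cell (Col T) (step_image k s)) (\<sigma> (step_tgt (step_image k s))))"
proof -
  have tgt: "step_tgt s \<in> column_words" using step_tgt_words[OF assms(1)] by simp
  show ?thesis
  proof (rule act_vcomp)
    show "act_cell (columns T) (Col T) k (step_cell (Col T) s) = Some (step_cell (Col T) (step_image k s))"
      by (rule act_step_cell[OF assms])
    show "act_cell (columns T) (Col T) k (\<sigma> (step_tgt s)) = Some (\<sigma> (step_tgt (step_image k s)))"
      by (rule \<sigma>_act[OF tgt]) (use step_image[OF assms] in blast)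
  qed (use step_cell[OF assms(1)] \<sigma>[OF tgt] in simp_all)
qed

lemma gamma_eq:
  "gamma T \<sigma> c1 c2 c3 =
    (vcomp (Col T) (step_cell (Col T) (left_step T c1 c2 c3)) (\<sigma> (step_tgt (left_step T c1 c2 c3))),
     vcomp (Col T) (step_cell (Col T) (right_step T c1 c2 c3)) (\<sigma> (step_tgt (right_step T c1 c2 c3))))"
  by (simp add: gamma_def left_step_def right_step_def)

text \<open>The targets agree because plactic equivalence is a congruence: normalizing
  \<open>c1 @ c2\<close> or \<open>c2 @ c3\<close> leaves the class of the whole word unchanged, so
  the strategy ends at the same tableau on both sides.\<close>

lemma gamma_sphere:
  assumes crit: "critical T c1 c2 c3"
  shows "gamma T \<sigma> c1 c2 c3 \<in> two_spheres (Col T)"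
    "cell_src (fst (gamma T \<sigma> c1 c2 c3)) = [c1, c2, c3]"
    "Pc T (c1 @ c2 @ c3) = Some (cell_tgt (fst (gamma T \<sigma> c1 c2 c3)))"
proof -
  let ?l = "left_step T c1 c2 c3" and ?r = "right_step T c1 c2 c3"
  note steps = critical_steps[OF crit]
  have c: "[c1] \<in> column_words" "[c3] \<in> column_words" "[c1, c2] \<in> column_words" "[c2, c3] \<in> column_words"
    using crit by (simp_all add: critical_def)
  obtain t where t: "Pc T (concat [c1, c2]) = Some t" "plactic T (concat t) (concat [c1, c2])"
    by (rule Pc_exists[OF c(3)])
  obtain t' where t': "Pc T (concat [c2, c3]) = Some t'" "plactic T (concat t') (concat [c2, c3])"
    by (rule Pc_exists[OF c(4)])
  have "plactic T (concat t @ c3) ((c1 @ c2) @ c3)" "plactic T (c1 @ concat t') (c1 @ (c2 @ c3))"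
    using plactic_append[OF t(2) plactic_refl[of c3]] plactic_append[OF plactic_refl[of c1] t'(2)]
      concat_in_words[OF c(1)] concat_in_words[OF c(2)] by simp_all
  then have Pc: "Pc T (concat (step_tgt ?l)) = Pc T (c1 @ c2 @ c3)"
    "Pc T (concat (step_tgt ?r)) = Pc T (c1 @ c2 @ c3)"
    using t(1) t'(1) Pc_cong by (simp_all add: left_step_def right_step_def)
  have left: "Pc T (c1 @ c2 @ c3) = Some (cell_tgt (fst (gamma T \<sigma> c1 c2 c3)))"
    and right: "Pc T (c1 @ c2 @ c3) = Some (cell_tgt (snd (gamma T \<sigma> c1 c2 c3)))"
    using step_strategy_cell(3)[OF steps(1)] step_strategy_cell(3)[OF steps(2)] Pc
    by (simp_all add: gamma_eq)
  then have "cell_tgt (fst (gamma T \<sigma> c1 c2 c3)) = cell_tgt (snd (gamma T \<sigma> c1 c2 c3))" by simp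
  with left show "gamma T \<sigma> c1 c2 c3 \<in> two_spheres (Col T)"
    "cell_src (fst (gamma T \<sigma> c1 c2 c3)) = [c1, c2, c3]"
    "Pc T (c1 @ c2 @ c3) = Some (cell_tgt (fst (gamma T \<sigma> c1 c2 c3)))"
    using step_strategy_cell(1,2)[OF steps(1)] step_strategy_cell(1,2)[OF steps(2)] steps(3,4)
    by (simp_all add: gamma_eq two_spheres_def)
qed

lemma gamma_act:
  assumes crit: "critical T c1 c2 c3" and act: "act_col k [c1, c2, c3] = Some [d1, d2, d3]"
  shows "act_sphere (columns T) (Col T) k (gamma T \<sigma> c1 c2 c3) = Some (gamma T \<sigma> d1 d2 d3)"
proof -
  note steps = critical_steps[OF crit]
  have "step_image k (left_step T c1 c2 c3) = left_step T d1 d2 d3"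
    "step_image k (right_step T c1 c2 c3) = right_step T d1 d2 d3"
    by (rule critical_act[OF crit act]; simp)+
  then show ?thesis
    using act_step_strategy_cell[OF steps(1), of k] act_step_strategy_cell[OF steps(2), of k]
      steps(3,4) act gamma_sphere(2)[OF crit]
    by (simp add: act_sphere_def gamma_eq)
qed

lemma gamma_from_highest_weight:
  assumes "critical T c1 c2 c3"
  shows "\<exists>S0\<in>hw_coherent_extension T \<sigma>.
    (S0, gamma T \<sigma> c1 c2 c3) \<in> {(A, B). \<exists>i. act_sphere (columns T) (Col T) (F i) A = Some B}\<^sup>*"
proof -
  interpret free: ranked_crystal "free_crystal (columns T)"
    by (rule columns.ranked_free_crystal)
  obtain r :: "column list \<Rightarrow> nat"
    where r: "\<forall>i x y. ee (free_crystal (columns T)) i x = Some y \<longrightarrow> r y < r x"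
    using free.ee_rank by blast
  show ?thesis
    using assms
  proof (induction "r [c1, c2, c3]" arbitrary: c1 c2 c3 rule: less_induct)
    case less
    show ?case
    proof (cases "highest_weight (free_crystal (columns T)) [c1, c2, c3]")
      case True
      then show ?thesis
        using less.prems by (intro bexI[of _ "gamma T \<sigma> c1 c2 c3"]) (auto simp: hw_coherent_extension_def)
    next
      case False
      then obtain i u where u: "act_col (E i) [c1, c2, c3] = Some u"
        using less.prems by (auto simp: highest_weight_def elts_free_crystal critical_def)
      obtain d1 d2 d3 where d: "u = [d1, d2, d3]" "critical T d1 d2 d3"
        by (rule critical_act[OF less.prems u])
      have "r [d1, d2, d3] < r [c1, c2, c3]" using r u d(1) by simp
      from less.hyps[OF this d(2)] obtain S0 where S0: "S0 \<in> hw_coherent_extension T \<sigma>"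
        "(S0, gamma T \<sigma> d1 d2 d3) \<in> {(A, B). \<exists>i. act_sphere (columns T) (Col T) (F i) A = Some B}\<^sup>*"
        by blast
      have "act_col (F i) [d1, d2, d3] = Some [c1, c2, c3]"
        using free.act_inverse[OF u] d(1) by simp
      from gamma_act[OF d(2) this] show ?thesis
        using S0 by (intro bexI[OF _ S0(1)]) (auto intro: rtrancl_into_rtrancl)
    qed
  qed
qed

end

theorem corollary4p3p1:
  fixes T :: cartan_type
    and \<sigma> :: "column list \<Rightarrow> column cell"
  assumes "classical_type T"
    and "crystal_normalization_strategy T \<sigma>"
  shows "(\<forall>c1 c2 c3. critical T c1 c2 c3 \<longrightarrow>
            gamma T \<sigma> c1 c2 c3 \<in> two_spheres (Col T) \<and>
            cell_src (fst (gamma T \<sigma> c1 c2 c3)) = [c1, c2, c3] \<and>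
            Pc T (c1 @ c2 @ c3) = Some (cell_tgt (fst (gamma T \<sigma> c1 c2 c3))))
       \<and> (\<forall>S\<in>coherent_extension T \<sigma>. \<exists>S0\<in>hw_coherent_extension T \<sigma>.
            (S0, S) \<in> {(A, B). \<exists>i. act_sphere (columns T) (Col T) (F i) A = Some B}\<^sup>*)"
proof -
  interpret column_strategy T \<sigma>
    by unfold_locales (rule assms)+
  show ?thesis
    using gamma_sphere gamma_from_highest_weight by (auto simp: coherent_extension_def)
qed

end
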